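(* Let $(X,\|\cdot\|)$ be a uniformly convex Banach space with strictly convex dual space $X^*$, and let $J\in C^1(X,\mathbb{R})$ be a functional with compact derivative. Assume that $\mu_1\in C^1(X,\mathbb{R})$ is sequentially weakly lower semicontinuous and coercive, and let $\mu_2\in C^1(X,\mathbb{R}_+)$ be a convex coercive functional. Assume that the derivative of $\mu_1$ is an operator $\mu_1':X\to X^*$ admitting a continuous inverse. Let $y\in X$ and $r>0$ be fixed. Assume that the following conditions are satisfied: 1. $\liminf_{\|x\|\to\infty}\frac{J(x)}{\mu_2(x)}\ge 0$; 2. $\inf_{x\in X}J(x)<\inf_{\mu_1(x)\le r}J(x)$; 3. $\mu_2(y)<r$ and $J(y)<\inf_{\mu_2(x)=r}J(x)$; 4. for all $x\in X$, $\mu_2(x)\le r$ implies $\mu_1(x)\le\mu_2(x)$; and there is a constant $M>0$ such that $\mu_1(x)\ge\mu_2(x)$ for all $x\in X$ with $\|x\|\ge M$; 5. $J$ is convex on the convex hull of $B:=\{x\in X:\mu_1(x)\le r\}$. Then there exists a nonempty open set $A\subset(0,+\infty)$ such that for all $\lambda\in A$ the functional $x\mapsto\mu_1(x)+\lambda J(x)$ has at least three critical points in $X$.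
   Context: Banach spaces are real. $\mathbb{R}_+=[0,+\infty)$. A functional $\mu$ on $X$ is coercive if $\mu(x)\to+\infty$ as $\|x\|\to\infty$. $J$ has compact derivative if $J':X\to X^*$ is a compact operator (continuous and mapping bounded sets to relatively compact sets). An operator $\mu':X\to X^*$ admits a continuous inverse if it is a bijection whose inverse $X^*\to X$ is continuous. A critical point of a $C^1$ functional $E$ is a point $x\in X$ with $E'(x)=0$. *)

theory Defs
  imports "HOL-Analysis.Analysis"
begin

definition uniformly_convex_space :: "'a::real_normed_vector itself \<Rightarrow> bool" where
  "uniformly_convex_space _ \<longleftrightarrow>
     (\<forall>\<epsilon>>0. \<exists>\<delta>>0. \<forall>x y :: 'a.
        norm x = 1 \<and> norm y = 1 \<and> norm (x - y) \<ge> \<epsilon>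
        \<longrightarrow> norm ((1/2) *\<^sub>R (x + y)) \<le> 1 - \<delta>)"

definition strictly_convex_space :: "'a::real_normed_vector itself \<Rightarrow> bool" where
  "strictly_convex_space _ \<longleftrightarrow>
     (\<forall>x y :: 'a. norm x = 1 \<and> norm y = 1 \<and> x \<noteq> y
        \<longrightarrow> norm ((1/2) *\<^sub>R (x + y)) < 1)"

text \<open>The dual of the space \<open>'a\<close> is the type \<open>'a \<Rightarrow>\<^sub>L real\<close> of bounded linear
  functionals, with the operator norm.\<close>

definition C1_with_derivative ::
  "('a::real_normed_vector \<Rightarrow> real) \<Rightarrow> ('a \<Rightarrow> 'a \<Rightarrow>\<^sub>L real) \<Rightarrow> bool" where
  "C1_with_derivative f f' \<longleftrightarrow>
     (\<forall>x. (f has_derivative blinfun_apply (f' x)) (at x)) \<and> continuous_on UNIV f'"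

definition critical_point :: "('a::real_normed_vector \<Rightarrow> real) \<Rightarrow> 'a \<Rightarrow> bool" where
  "critical_point E x \<longleftrightarrow> (E has_derivative (\<lambda>_. 0)) (at x)"

definition compact_operator ::
  "('a::real_normed_vector \<Rightarrow> 'b::real_normed_vector) \<Rightarrow> bool" where
  "compact_operator T \<longleftrightarrow>
     continuous_on UNIV T \<and> (\<forall>S. bounded S \<longrightarrow> compact (closure (T ` S)))"

definition admits_continuous_inverse ::
  "('a::topological_space \<Rightarrow> 'b::topological_space) \<Rightarrow> bool" where
  "admits_continuous_inverse T \<longleftrightarrow> bij T \<and> continuous_on UNIV (inv T)"

definition coercive :: "('a::real_normed_vector \<Rightarrow> real) \<Rightarrow> bool" where
  "coercive f \<longleftrightarrow> filterlim f at_top at_infinity"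

definition weakly_converges :: "(nat \<Rightarrow> 'a::real_normed_vector) \<Rightarrow> 'a \<Rightarrow> bool" where
  "weakly_converges u x \<longleftrightarrow>
     (\<forall>\<phi> :: 'a \<Rightarrow>\<^sub>L real. (\<lambda>n. blinfun_apply \<phi> (u n)) \<longlonglongrightarrow> blinfun_apply \<phi> x)"

definition seq_weakly_lsc :: "('a::real_normed_vector \<Rightarrow> real) \<Rightarrow> bool" where
  "seq_weakly_lsc f \<longleftrightarrow>
     (\<forall>u x. weakly_converges u x \<longrightarrow> ereal (f x) \<le> liminf (\<lambda>n. ereal (f (u n))))"

end

theory Submission
  imports Defs "HOL-Library.Diagonal_Subsequence"
begin

text \<open>
  Put \<open>B = {\<mu>\<^sub>1 \<le> r}\<close> and \<open>C = {\<mu>\<^sub>2 \<le> r}\<close>, so that \<open>C \<subseteq> B\<close>. The convex functional \<open>J\<close> attains its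
  minimum over the bounded closed convex set \<open>C\<close> at a point \<open>x0\<close>, and since \<open>J y\<close> lies below the
  values of \<open>J\<close> on \<open>{\<mu>\<^sub>2 = r}\<close>, the point \<open>x0\<close> satisfies \<open>\<mu>\<^sub>1 x0 \<le> \<mu>\<^sub>2 x0 < r\<close>. Convexity of \<open>J\<close> on the
  hull of \<open>B\<close> turns \<open>x0\<close> into a minimum over all of \<open>B\<close>
  (\<open>convex_minimum_across_wall\<close>). On the other hand there is a point \<open>z\<close> with
  \<open>J z < J x0\<close>, which must lie outside \<open>B\<close>.

  For \<open>l > 0\<close> let \<open>E = \<mu>\<^sub>1 + l * J\<close>. On the wall \<open>{\<mu>\<^sub>1 = r}\<close> one has
  \<open>E x \<ge> \<rho> = r + l * J x0 > E x0\<close>, so \<open>E\<close> restricted to \<open>B\<close> has its minimum at a point \<open>x1\<close> in the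
  interior of \<open>B\<close>. Since \<open>\<mu>\<^sub>1\<close> is bounded below, for all large \<open>l\<close> the value \<open>E z\<close> is smaller than every
  value of \<open>E\<close> on \<open>B\<close>, so a global minimum \<open>x3\<close> satisfies \<open>E x3 < E x1\<close>. Every path from \<open>x0\<close> to
  \<open>z\<close> crosses the wall, so a mountain pass point \<open>x2\<close> has \<open>E x2 \<ge> \<rho> > E x1\<close>. These three
  critical points lie on three different levels, and the open set can be taken to be a half-line.

  Compactness enters in two ways. The functional \<open>E\<close> is coercive (\<open>coercive_perturbation\<close>),
  and as \<open>J'\<close> is compact and \<open>\<mu>\<^sub>1'\<close> has a continuous inverse, \<open>E\<close> has the Palais-Smale property
  (\<open>palais_smale_compact_perturbation\<close>). Together with the variational principle of Ekeland this
  yields the two minima (\<open>minimum_critical\<close>) and, applied in the space of paths, the mountain pass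
  point (\<open>mountain_pass\<close>). The lower bound of \<open>\<mu>\<^sub>1\<close> and the existence of \<open>x0\<close> come from uniform
  convexity: every bounded sequence has a subsequence such that a single point lies in all closed
  convex hulls of tails of all further subsequences (\<open>uniformly_convex_tail_hull_subseq\<close>); in
  particular that subsequence converges weakly.
\<close>

section \<open>Bounded sequences in uniformly convex spaces\<close>

text \<open>
  Uniform convexity speaks of the unit sphere only. Here it is transferred to two sequences whose
  norms, and those of whose midpoints, approach a common value \<open>\<nu>\<close>: normalising the
  sequences changes the midpoints by an amount controlled by the difference of the norms.
\<close>

lemma uniformly_convex_diff_tendsto_0:
  fixes u v :: "nat \<Rightarrow> 'a::real_normed_vector"
  assumes uc: "uniformly_convex_space TYPE('a)"
    and u: "(\<lambda>n. norm (u n)) \<longlonglongrightarrow> \<nu>" and v: "(\<lambda>n. norm (v n)) \<longlonglongrightarrow> \<nu>"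
    and w: "w \<longlonglongrightarrow> \<nu>" and le: "\<And>n. w n \<le> norm ((1/2) *\<^sub>R (u n + v n))"
  shows "(\<lambda>n. u n - v n) \<longlonglongrightarrow> 0"
proof (cases "\<nu> = 0")
  case True
  then have "u \<longlonglongrightarrow> 0" "v \<longlonglongrightarrow> 0"
    using u v by (auto intro: tendsto_norm_zero_cancel)
  then show ?thesis using tendsto_diff[of u 0 sequentially v 0] by simp
next
  case False
  have "\<nu> \<ge> 0" using u by (rule LIMSEQ_le_const) auto
  with False have pos: "\<nu> > 0" by simp
  show ?thesis
  proof (rule tendstoI)
    fix e' :: real assume "e' > 0"
    define e where "e = e' / (\<nu> + 1)"
    have "e > 0" "\<nu> * e < e'" using \<open>e' > 0\<close> pos by (auto simp: e_def field_simps)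
    obtain \<delta> where "\<delta> > 0" and \<delta>: "\<And>x y :: 'a. norm x = 1 \<Longrightarrow> norm y = 1 \<Longrightarrow> norm (x - y) \<ge> e
        \<Longrightarrow> norm ((1/2) *\<^sub>R (x + y)) \<le> 1 - \<delta>"
      using uc \<open>e > 0\<close> unfolding uniformly_convex_space_def by metis
    have "(\<lambda>n. w n - norm (u n) * (1 - \<delta>) - \<bar>norm (v n) - norm (u n)\<bar> / 2)
        \<longlonglongrightarrow> \<nu> - \<nu> * (1 - \<delta>) - \<bar>\<nu> - \<nu>\<bar> / 2"
      by (intro tendsto_intros u v w) auto
    moreover have "\<nu> - \<nu> * (1 - \<delta>) - \<bar>\<nu> - \<nu>\<bar> / 2 > 0"
      using pos \<open>\<delta> > 0\<close> by (simp add: algebra_simps)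
    ultimately have ev1: "\<forall>\<^sub>F n in sequentially. w n - norm (u n) * (1 - \<delta>) - \<bar>norm (v n) - norm (u n)\<bar> / 2 > 0"
      by (rule order_tendstoD)
    have "(\<lambda>n. norm (u n) * e + \<bar>norm (v n) - norm (u n)\<bar>) \<longlonglongrightarrow> \<nu> * e + \<bar>\<nu> - \<nu>\<bar>"
      by (intro tendsto_intros u v w)
    moreover have "\<nu> * e + \<bar>\<nu> - \<nu>\<bar> < e'"
      using \<open>\<nu> * e < e'\<close> by simp
    ultimately have ev2: "\<forall>\<^sub>F n in sequentially. norm (u n) * e + \<bar>norm (v n) - norm (u n)\<bar> < e'"
      by (rule order_tendstoD)
    have ev3: "\<forall>\<^sub>F n in sequentially. norm (u n) > 0" "\<forall>\<^sub>F n in sequentially. norm (v n) > 0"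
      using order_tendstoD(1)[OF u pos] order_tendstoD(1)[OF v pos] by auto
    show "\<forall>\<^sub>F n in sequentially. dist (u n - v n) 0 < e'"
      using ev1 ev2 ev3
    proof eventually_elim
      case (elim n)
      define a b U V where "a = norm (u n)" "b = norm (v n)" "U = u n /\<^sub>R a" "V = v n /\<^sub>R b"
      have ab: "a > 0" "b > 0" using elim by (auto simp: a_b_U_V_def)
      have UV: "norm U = 1" "norm V = 1" "u n = a *\<^sub>R U" "v n = b *\<^sub>R V"
        using ab by (auto simp: a_b_U_V_def)
      have "norm (U - V) < e"
      proof (rule ccontr)
        assume "\<not> norm (U - V) < e"
        then have "norm ((1/2) *\<^sub>R (U + V)) \<le> 1 - \<delta>"
          using \<delta> UV by simp
        then have "a * norm ((1/2) *\<^sub>R (U + V)) \<le> a * (1 - \<delta>)"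
          using ab by (intro mult_left_mono) auto
        moreover have "(1/2) *\<^sub>R (u n + v n) = a *\<^sub>R ((1/2) *\<^sub>R (U + V)) + ((b - a) / 2) *\<^sub>R V"
          using UV by (simp add: algebra_simps add_divide_distrib diff_divide_distrib flip: scaleR_add_left scaleR_diff_left)
        then have "norm ((1/2) *\<^sub>R (u n + v n)) \<le> norm (a *\<^sub>R ((1/2) *\<^sub>R (U + V))) + norm (((b - a) / 2) *\<^sub>R V)"
          by (metis norm_triangle_ineq)
        then have "norm ((1/2) *\<^sub>R (u n + v n)) \<le> a * norm ((1/2) *\<^sub>R (U + V)) + \<bar>b - a\<bar> / 2"
          using UV(2) ab by simp
        ultimately show False
          using elim(1) le[of n] by (simp add: a_b_U_V_def)
      qed
      have "u n - v n = a *\<^sub>R (U - V) - (b - a) *\<^sub>R V"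
        using UV by (simp add: algebra_simps)
      then have "norm (u n - v n) \<le> a * norm (U - V) + \<bar>b - a\<bar>"
        using norm_triangle_ineq4[of "a *\<^sub>R (U - V)" "(b - a) *\<^sub>R V"] UV(2) ab by simp
      also have "\<dots> \<le> a * e + \<bar>b - a\<bar>"
        using \<open>norm (U - V) < e\<close> ab by (intro add_right_mono mult_left_mono) auto
      also have "\<dots> < e'" using elim(2) by (simp add: a_b_U_V_def)
      finally show ?case by simp
    qed
  qed
qed

text \<open>
  The convex hulls of the tails of a bounded sequence decrease, so the infima of the norm over them
  increase to a limit, the asymptotic norm. Passing to a subsequence shrinks the hulls and can only
  increase this limit.
\<close>

definition tail_hull :: "(nat \<Rightarrow> 'a::real_vector) \<Rightarrow> nat \<Rightarrow> 'a set" where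
  "tail_hull u m = convex hull (u ` {m..})"

definition tail_inf_norm :: "(nat \<Rightarrow> 'a::real_normed_vector) \<Rightarrow> nat \<Rightarrow> real" where
  "tail_inf_norm u m = (INF c\<in>tail_hull u m. norm c)"

definition asymptotic_norm :: "(nat \<Rightarrow> 'a::real_normed_vector) \<Rightarrow> real" where
  "asymptotic_norm u = (SUP m. tail_inf_norm u m)"

lemma tail_hull_nonempty: "tail_hull u m \<noteq> {}"
  by (auto simp: tail_hull_def)

lemma tail_hull_antimono: "m \<le> n \<Longrightarrow> tail_hull u n \<subseteq> tail_hull u m"
  unfolding tail_hull_def by (intro hull_mono image_mono) auto

lemma tail_hull_subseq:
  assumes "strict_mono (r :: nat \<Rightarrow> nat)"
  shows "tail_hull (u \<circ> r) m \<subseteq> tail_hull u m"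
  unfolding tail_hull_def
proof (rule hull_mono, safe)
  fix n assume "m \<le> n"
  then have "m \<le> r n" using seq_suble[OF assms, of n] by simp
  then show "(u \<circ> r) n \<in> u ` {m..}" by simp
qed

lemma tail_inf_norm_le: "c \<in> tail_hull u m \<Longrightarrow> tail_inf_norm u m \<le> norm c"
  unfolding tail_inf_norm_def by (rule cINF_lower) (auto intro: bdd_belowI[of _ 0])

lemma tail_inf_norm_antimono:
  "tail_hull v n \<subseteq> tail_hull u m \<Longrightarrow> tail_inf_norm u m \<le> tail_inf_norm v n"
  unfolding tail_inf_norm_def
  by (rule cINF_superset_mono) (auto simp: tail_hull_nonempty intro: bdd_belowI[of _ 0])

lemma tail_inf_norm_bound:
  assumes "\<And>n. norm (u n) \<le> b"
  shows "tail_inf_norm u m \<le> b"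
  using tail_inf_norm_le[of "u m" u m] assms[of m]
  by (force simp: tail_hull_def intro: hull_inc)

lemma asymptotic_norm_bound:
  assumes "\<And>n. norm (u n) \<le> b"
  shows "asymptotic_norm u \<le> b"
  unfolding asymptotic_norm_def
  by (rule cSUP_least) (auto intro: tail_inf_norm_bound[OF assms])

lemma tail_inf_norm_le_asymptotic:
  assumes "\<And>n. norm (u n) \<le> b"
  shows "tail_inf_norm u m \<le> asymptotic_norm u"
  unfolding asymptotic_norm_def
  by (rule cSUP_upper) (auto intro!: bdd_aboveI[of _ b] tail_inf_norm_bound[OF assms])

lemma tail_inf_norm_tendsto:
  assumes "\<And>n. norm (u n) \<le> b"
  shows "tail_inf_norm u \<longlonglongrightarrow> asymptotic_norm u"
  unfolding asymptotic_norm_def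
  by (rule LIMSEQ_incseq_SUP)
    (auto intro!: bdd_aboveI[of _ b] tail_inf_norm_bound[OF assms] tail_inf_norm_antimono
       tail_hull_antimono incseq_SucI)

lemma asymptotic_norm_subseq:
  assumes b: "\<And>n. norm (u n) \<le> b" and r: "strict_mono r"
  shows "asymptotic_norm u \<le> asymptotic_norm (u \<circ> r)"
proof -
  have "tail_inf_norm u m \<le> asymptotic_norm (u \<circ> r)" for m
  proof (rule order_trans)
    show "tail_inf_norm u m \<le> tail_inf_norm (u \<circ> r) m"
      by (rule tail_inf_norm_antimono[OF tail_hull_subseq[OF r]])
    show "tail_inf_norm (u \<circ> r) m \<le> asymptotic_norm (u \<circ> r)"
      by (rule tail_inf_norm_le_asymptotic[of _ b]) (simp add: b)
  qed
  then show ?thesis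
    unfolding asymptotic_norm_def[of u] by (intro cSUP_least) auto
qed

lemma asymptotic_norm_shift:
  assumes b: "\<And>n. norm (u n) \<le> b"
  shows "asymptotic_norm (u \<circ> (+) k) \<le> asymptotic_norm u"
  unfolding asymptotic_norm_def[of "u \<circ> (+) k"]
proof (rule cSUP_least)
  fix m
  have "tail_hull u (k + m) \<subseteq> tail_hull (u \<circ> (+) k) m"
    unfolding tail_hull_def
  proof (rule hull_mono, safe)
    fix n assume "k + m \<le> n"
    then have "u n = (u \<circ> (+) k) (n - k)" "m \<le> n - k" by auto
    then show "u n \<in> (u \<circ> (+) k) ` {m..}" by (metis atLeast_iff imageI)
  qed
  then show "tail_inf_norm (u \<circ> (+) k) m \<le> asymptotic_norm u"
    by (rule order_trans[OF tail_inf_norm_antimono tail_inf_norm_le_asymptotic[of u b, OF b]])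
qed auto

text \<open>
  The asymptotic norm is monotone under passing to subsequences and bounded, so it can be exhausted:
  the \<open>n\<close>-th refinement is chosen to bring it within \<open>1/(n+1)\<close> of its supremum over further
  refinements, and the diagonal subsequence admits no further increase at all. Only tails of the
  diagonal sequence are subsequences of the \<open>n\<close>-th refinement; this is harmless because
  the asymptotic norm depends on tails only.
\<close>

lemma asymptotic_norm_regular_subseq:
  fixes u :: "nat \<Rightarrow> 'a::real_normed_vector"
  assumes b: "\<And>n. norm (u n) \<le> b"
  shows "\<exists>s. strict_mono s \<and>
    (\<forall>r. strict_mono r \<longrightarrow> asymptotic_norm (u \<circ> s \<circ> r) = asymptotic_norm (u \<circ> s))"
proof -
  have bs: "norm ((u \<circ> s) n) \<le> b" for s n using b by simp
  define P where "P n s \<longleftrightarrow> (\<forall>r. strict_mono r \<longrightarrow>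
    asymptotic_norm (u \<circ> (s \<circ> r)) \<le> asymptotic_norm (u \<circ> s) + inverse (real (Suc n)))" for n s
  interpret subseqs P
  proof
    fix n and s :: "nat \<Rightarrow> nat" assume "strict_mono s"
    define T where "T = (\<lambda>r. asymptotic_norm (u \<circ> (s \<circ> r))) ` {r. strict_mono r}"
    have T: "T \<noteq> {}" "bdd_above T"
      using strict_mono_id
      by (auto simp: T_def intro!: bdd_aboveI[of _ b] asymptotic_norm_bound b)
    have "Sup T - inverse (real (Suc n)) < Sup T" by simp
    then obtain r' where r': "strict_mono r'"
      "Sup T - inverse (real (Suc n)) < asymptotic_norm (u \<circ> (s \<circ> r'))"
      unfolding less_cSup_iff[OF T] by (auto simp: T_def)
    have "P n (s \<circ> r')"
      unfolding P_def
    proof safe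
      fix r :: "nat \<Rightarrow> nat" assume "strict_mono r"
      then have "asymptotic_norm (u \<circ> (s \<circ> r' \<circ> r)) \<in> T"
        using r'(1) unfolding T_def by (auto simp: comp_assoc strict_mono_o)
      then have "asymptotic_norm (u \<circ> (s \<circ> r' \<circ> r)) \<le> Sup T" using T(2) by (rule cSup_upper)
      then show "asymptotic_norm (u \<circ> (s \<circ> r' \<circ> r)) \<le> asymptotic_norm (u \<circ> (s \<circ> r')) + inverse (real (Suc n))"
        using r'(2) by simp
    qed
    then show "\<exists>r'. strict_mono r' \<and> P n (s \<circ> r')" using r'(1) by blast
  qed
  have stable: "P n (s \<circ> r)" if r: "strict_mono r" and P: "P n s" for n s r
    unfolding P_def
  proof safe
    fix r' :: "nat \<Rightarrow> nat" assume r': "strict_mono r'"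
    have "asymptotic_norm (u \<circ> (s \<circ> r \<circ> r')) \<le> asymptotic_norm (u \<circ> s) + inverse (real (Suc n))"
      using P strict_mono_o[OF r r'] by (simp add: P_def comp_assoc)
    also have "asymptotic_norm (u \<circ> s) \<le> asymptotic_norm (u \<circ> (s \<circ> r))"
      using asymptotic_norm_subseq[of "u \<circ> s" b, OF bs r] by (simp add: comp_assoc)
    finally show "asymptotic_norm (u \<circ> (s \<circ> r \<circ> r')) \<le> asymptotic_norm (u \<circ> (s \<circ> r)) + inverse (real (Suc n))"
      by simp
  qed
  have "asymptotic_norm (u \<circ> diagseq \<circ> r) = asymptotic_norm (u \<circ> diagseq)" if r: "strict_mono r" for r
  proof (rule antisym)
    have "asymptotic_norm (u \<circ> diagseq \<circ> r) \<le> asymptotic_norm (u \<circ> diagseq) + inverse (real (Suc k))" for k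
    proof -
      define h where "h = (+) (Suc k)"
      (* r' describes r on the tail that starts at Suc k, reindexed to start at 0. *)
      define r' where "r' n = r (Suc k + n) - Suc k" for n
      have hr: "h \<circ> r' = r \<circ> h"
      proof
        fix n
        have "Suc k + n \<le> r (Suc k + n)" using seq_suble[OF r] .
        then show "(h \<circ> r') n = (r \<circ> h) n" by (simp add: h_def r'_def)
      qed
      have mh: "strict_mono h" by (auto simp: h_def strict_mono_def)
      have mr': "strict_mono r'"
      proof (rule strict_monoI)
        fix m n :: nat assume "m < n"
        then have "(r \<circ> h) m < (r \<circ> h) n" by (rule strict_monoD[OF strict_mono_o[OF r mh]])
        then show "r' m < r' n" unfolding hr[symmetric] by (simp add: h_def)
      qed
      have "asymptotic_norm (u \<circ> diagseq \<circ> r) \<le> asymptotic_norm (u \<circ> diagseq \<circ> r \<circ> h)"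
        by (rule asymptotic_norm_subseq[OF _ mh, of _ b]) (use b in simp)
      also have "u \<circ> diagseq \<circ> r \<circ> h = u \<circ> (diagseq \<circ> h \<circ> r')"
        by (simp add: comp_assoc hr)
      also have "asymptotic_norm \<dots> \<le> asymptotic_norm (u \<circ> (diagseq \<circ> h)) + inverse (real (Suc k))"
        using diagseq_holds[of k, OF stable] mr' by (auto simp: P_def h_def)
      also have "asymptotic_norm (u \<circ> (diagseq \<circ> h)) \<le> asymptotic_norm (u \<circ> diagseq)"
        unfolding h_def comp_assoc[symmetric] by (rule asymptotic_norm_shift[of _ b]) (use b in simp)
      finally show ?thesis by (simp only: add_right_mono)
    qed
    moreover have "(\<lambda>k. asymptotic_norm (u \<circ> diagseq) + inverse (real (Suc k)))
        \<longlonglongrightarrow> asymptotic_norm (u \<circ> diagseq) + 0"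
      by (intro tendsto_add tendsto_const LIMSEQ_inverse_real_of_nat)
    ultimately show "asymptotic_norm (u \<circ> diagseq \<circ> r) \<le> asymptotic_norm (u \<circ> diagseq)"
      using LIMSEQ_le_const by fastforce
  next
    show "asymptotic_norm (u \<circ> diagseq) \<le> asymptotic_norm (u \<circ> diagseq \<circ> r)"
      by (rule asymptotic_norm_subseq[OF _ r, of _ b]) (use b in simp)
  qed
  then show ?thesis using subseq_diagseq by blast
qed

lemma tail_hull_minimizing_sequence:
  assumes "\<And>n. norm (u n) \<le> b"
  obtains c where "\<And>m. c m \<in> tail_hull u m" "(\<lambda>m. norm (c m)) \<longlonglongrightarrow> asymptotic_norm u"
proof -
  have "\<exists>c\<in>tail_hull u m. norm c < tail_inf_norm u m + inverse (real (Suc m))" for m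
  proof -
    have "(INF c\<in>tail_hull u m. norm c) < tail_inf_norm u m + inverse (real (Suc m))"
      by (simp add: tail_inf_norm_def)
    then show ?thesis
      by (subst (asm) cINF_less_iff) (auto simp: tail_hull_nonempty intro: bdd_belowI[of _ 0])
  qed
  then obtain c where c: "\<And>m. c m \<in> tail_hull u m"
    "\<And>m. norm (c m) < tail_inf_norm u m + inverse (real (Suc m))" by metis
  have "(\<lambda>m. tail_inf_norm u m + inverse (real (Suc m))) \<longlonglongrightarrow> asymptotic_norm u + 0"
    by (intro tendsto_add tail_inf_norm_tendsto[of u b, OF assms] LIMSEQ_inverse_real_of_nat)
  then have upper: "(\<lambda>m. tail_inf_norm u m + inverse (real (Suc m))) \<longlonglongrightarrow> asymptotic_norm u"
    by simp
  have "(\<lambda>m. norm (c m)) \<longlonglongrightarrow> asymptotic_norm u"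
    by (rule tendsto_sandwich[OF _ _ tail_inf_norm_tendsto[of u b, OF assms] upper])
      (auto intro!: always_eventually less_imp_le[OF c(2)] tail_inf_norm_le c(1) simp del: of_nat_Suc)
  with c(1) that show thesis by blast
qed

text \<open>
  On a subsequence with maximal asymptotic norm, the almost shortest elements of the tail hulls of
  every further subsequence all have norms tending to the same value \<open>\<nu>\<close>. Midpoints of such
  elements lie in the tail hulls again and so cannot be substantially shorter than \<open>\<nu>\<close>. By
  uniform convexity the elements form a Cauchy sequence, with the same limit for every further
  subsequence. The result takes the place of reflexivity.
\<close>

proposition uniformly_convex_tail_hull_subseq:
  fixes u :: "nat \<Rightarrow> 'a::banach"
  assumes uc: "uniformly_convex_space TYPE('a)" and bdd: "bounded (range u)"
  shows "\<exists>(s :: nat \<Rightarrow> nat) x. strict_mono s \<and>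
    (\<forall>(r :: nat \<Rightarrow> nat) m. strict_mono r \<longrightarrow> x \<in> closure (tail_hull (u \<circ> s \<circ> r) m))"
proof -
  obtain b where b: "\<And>n. norm (u n) \<le> b" using bdd by (auto simp: bounded_iff)
  obtain s where s: "strict_mono s" and
    reg: "\<And>r. strict_mono r \<Longrightarrow> asymptotic_norm (u \<circ> s \<circ> r) = asymptotic_norm (u \<circ> s)"
    using asymptotic_norm_regular_subseq[of u b, OF b] by blast
  define v \<nu> where "v = u \<circ> s" "\<nu> = asymptotic_norm v"
  have bv: "norm (v n) \<le> b" "norm ((v \<circ> r) n) \<le> b" for n r using b by (auto simp: v_\<nu>_def)
  have diff: "(\<lambda>m. c m - d m) \<longlonglongrightarrow> 0"
    if "\<And>m. c m \<in> tail_hull v m" "(\<lambda>m. norm (c m)) \<longlonglongrightarrow> \<nu>"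
      "\<And>m. d m \<in> tail_hull v m" "(\<lambda>m. norm (d m)) \<longlonglongrightarrow> \<nu>" for c d
  proof (rule uniformly_convex_diff_tendsto_0[OF uc that(2,4)])
    show "tail_inf_norm v \<longlonglongrightarrow> \<nu>" unfolding v_\<nu>_def(2) by (rule tail_inf_norm_tendsto[of v b, OF bv(1)])
    show "tail_inf_norm v n \<le> norm ((1/2) *\<^sub>R (c n + d n))" for n
    proof (rule tail_inf_norm_le)
      have "convex (tail_hull v n)" by (simp add: tail_hull_def)
      from convexD[OF this that(1,3), of "1/2" "1/2"]
      show "(1/2) *\<^sub>R (c n + d n) \<in> tail_hull v n" by (simp add: scaleR_add_right)
    qed
  qed
  obtain c where c: "\<And>m. c m \<in> tail_hull v m" "(\<lambda>m. norm (c m)) \<longlonglongrightarrow> \<nu>"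
    using tail_hull_minimizing_sequence[of v b, OF bv(1)] unfolding v_\<nu>_def(2) by blast
  have "Cauchy c"
  proof (rule ccontr)
    assume "\<not> Cauchy c"
    then obtain e where e: "e > 0" "\<forall>M. \<exists>m\<ge>M. \<exists>n\<ge>M. \<not> dist (c m) (c n) < e"
      unfolding Cauchy_def by blast
    then obtain p q where pq: "\<And>M. p M \<ge> M" "\<And>M. q M \<ge> M" "\<And>M. \<not> dist (c (p M)) (c (q M)) < e"
      by metis
    have "filterlim p at_top sequentially" "filterlim q at_top sequentially"
      using pq(1,2) by (auto intro: filterlim_at_top_mono[OF filterlim_ident] always_eventually)
    then have "(\<lambda>m. norm (c (p m))) \<longlonglongrightarrow> \<nu>" "(\<lambda>m. norm (c (q m))) \<longlonglongrightarrow> \<nu>"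
      using filterlim_compose[OF c(2)] by auto
    then have "(\<lambda>m. c (p m) - c (q m)) \<longlonglongrightarrow> 0"
      using c(1) pq(1,2) tail_hull_antimono by (intro diff) blast+
    from tendstoD[OF this e(1)] obtain M where "norm (c (p M) - c (q M)) < e"
      by (auto simp: eventually_sequentially)
    then show False using pq(3) by (simp add: dist_norm)
  qed
  then obtain x where x: "c \<longlonglongrightarrow> x" by (auto simp: Cauchy_convergent_iff convergent_def)
  have "x \<in> closure (tail_hull (v \<circ> r) m)" if r: "strict_mono r" for r :: "nat \<Rightarrow> nat" and m
  proof -
    obtain d where d: "\<And>m. d m \<in> tail_hull (v \<circ> r) m" "(\<lambda>m. norm (d m)) \<longlonglongrightarrow> \<nu>"
      using tail_hull_minimizing_sequence[of "v \<circ> r" b, OF bv(2)] reg[OF r] unfolding v_\<nu>_def by metis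
    have "(\<lambda>m. c m - d m) \<longlonglongrightarrow> 0"
      using d tail_hull_subseq[OF r] by (intro diff c) blast+
    from tendsto_diff[OF x this] have "(\<lambda>n. d (n + m)) \<longlonglongrightarrow> x"
      by (intro LIMSEQ_ignore_initial_segment) simp
    moreover have "d (n + m) \<in> tail_hull (v \<circ> r) m" for n
      using d(1)[of "n + m"] tail_hull_antimono[of m "n + m"] by auto
    ultimately show ?thesis
      unfolding closure_sequential by (intro exI[of _ "\<lambda>n. d (n + m)"]) simp
  qed
  then show ?thesis using s by (auto simp: v_\<nu>_def)
qed

text \<open>
  If a functional stayed away from its value at \<open>x\<close> along a further subsequence, a closed half-space
  would contain the tail hulls of that subsequence but not \<open>x\<close>.
\<close>

corollary uniformly_convex_weakly_convergent_subseq: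
  fixes u :: "nat \<Rightarrow> 'a::banach"
  assumes "uniformly_convex_space TYPE('a)" and "bounded (range u)"
  shows "\<exists>s x. strict_mono s \<and> weakly_converges (u \<circ> s) x"
proof -
  obtain s :: "nat \<Rightarrow> nat" and x where s: "strict_mono s"
    and x: "\<And>(r :: nat \<Rightarrow> nat) m. strict_mono r \<Longrightarrow> x \<in> closure (tail_hull (u \<circ> s \<circ> r) m)"
    using uniformly_convex_tail_hull_subseq[OF assms] by blast
  have one_sided: "\<forall>\<^sub>F n in sequentially. blinfun_apply \<phi> ((u \<circ> s) n) < blinfun_apply \<phi> x + e"
    if "e > 0" for \<phi> :: "'a \<Rightarrow>\<^sub>L real" and e
  proof (rule ccontr)
    assume "\<not> ?thesis"
    then have "\<exists>\<^sub>F n in sequentially. blinfun_apply \<phi> ((u \<circ> s) n) \<ge> blinfun_apply \<phi> x + e"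
      by (simp add: not_eventually not_less)
    then have "infinite {n. blinfun_apply \<phi> ((u \<circ> s) n) \<ge> blinfun_apply \<phi> x + e}"
      by (simp add: cofinite_eq_sequentially[symmetric] frequently_cofinite)
    from infinite_enumerate[OF this] obtain r where r: "strict_mono (r :: nat \<Rightarrow> nat)"
      "\<And>n. blinfun_apply \<phi> ((u \<circ> s) (r n)) \<ge> blinfun_apply \<phi> x + e" by auto
    define H where "H = blinfun_apply \<phi> -` {blinfun_apply \<phi> x + e ..}"
    have "convex H" unfolding H_def
      by (intro convex_linear_vimage) (auto intro: bounded_linear.linear[OF blinfun.bounded_linear_right])
    moreover have "closed H" unfolding H_def
      by (intro closed_vimage) (auto intro: continuous_intros)
    moreover have "range (u \<circ> s \<circ> r) \<subseteq> H" using r(2) by (auto simp: H_def)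
    ultimately have "closure (tail_hull (u \<circ> s \<circ> r) 0) \<subseteq> H"
      unfolding tail_hull_def by (intro closure_minimal hull_minimal) auto
    then have "x \<in> H" using x[OF r(1)] by blast
    then show False using \<open>e > 0\<close> by (simp add: H_def)
  qed
  have "weakly_converges (u \<circ> s) x"
    unfolding weakly_converges_def
  proof (intro allI tendstoI)
    fix \<phi> :: "'a \<Rightarrow>\<^sub>L real" and e :: real assume "e > 0"
    show "\<forall>\<^sub>F n in sequentially. dist (blinfun_apply \<phi> ((u \<circ> s) n)) (blinfun_apply \<phi> x) < e"
      using one_sided[OF \<open>e > 0\<close>, of \<phi>] one_sided[OF \<open>e > 0\<close>, of "- \<phi>"]
      by eventually_elim (auto simp: dist_real_def uminus_blinfun.rep_eq)
  qed
  then show ?thesis using s by blast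
qed

section \<open>The Ekeland variational principle\<close>

text \<open>
  Write \<open>y \<in> T x\<close> when going from \<open>x\<close> to \<open>y\<close> lowers \<open>f\<close> by at least \<open>\<epsilon>\<close> times the
  distance. This is a partial order with closed sections. Descending along it, each time almost to the
  infimum of \<open>f\<close> over the current section, gives a Cauchy sequence, because the total descent is
  bounded; no point of the section at its limit has a smaller value of \<open>f\<close>.
\<close>

theorem Ekeland_variational_principle:
  fixes f :: "'a::complete_space \<Rightarrow> real"
  assumes x0: "x0 \<in> S" and bdd: "\<And>x. x \<in> S \<Longrightarrow> b \<le> f x"
    and lsc: "\<And>a. closed {x \<in> S. f x \<le> a}" and eps: "\<epsilon> > 0"
  obtains x where "x \<in> S" "f x + \<epsilon> * dist x0 x \<le> f x0" "\<And>y. y \<in> S \<Longrightarrow> f x \<le> f y + \<epsilon> * dist x y"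
proof -
  define T where "T x = {y \<in> S. f y + \<epsilon> * dist x y \<le> f x}" for x
  have T_self: "x \<in> T x" if "x \<in> S" for x using that by (simp add: T_def)
  have T_trans: "z \<in> T x" if "y \<in> T x" "z \<in> T y" for x y z
  proof -
    have "\<epsilon> * dist x z \<le> \<epsilon> * dist x y + \<epsilon> * dist y z"
      using mult_left_mono[OF dist_triangle[of x z y], of \<epsilon>] eps by (simp add: algebra_simps)
    then show ?thesis using that by (auto simp: T_def)
  qed
  have T_closed: "closed (T x)" for x
  proof (unfold closed_sequential_limits, safe)
    fix u y assume u: "\<forall>n. u n \<in> T x" "u \<longlonglongrightarrow> y"
    have below: "y \<in> {z \<in> S. f z \<le> f x - \<epsilon> * dist x y + \<delta>}" if "\<delta> > 0" for \<delta>
    proof (rule Lim_in_closed_set[OF lsc])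
      have "(\<lambda>n. \<epsilon> * dist x (u n)) \<longlonglongrightarrow> \<epsilon> * dist x y"
        by (intro tendsto_intros u(2))
      then have "\<forall>\<^sub>F n in sequentially. \<epsilon> * dist x (u n) > \<epsilon> * dist x y - \<delta>"
        using that by (intro order_tendstoD) auto
      then show "\<forall>\<^sub>F n in sequentially. u n \<in> {z \<in> S. f z \<le> f x - \<epsilon> * dist x y + \<delta>}"
      proof eventually_elim
        case (elim n)
        have "u n \<in> T x" using u(1) by blast
        with elim show ?case by (auto simp: T_def)
      qed
    qed (use u(2) in auto)
    have "f y \<le> f x - \<epsilon> * dist x y"
      by (rule field_le_epsilon) (use below in auto)
    then show "y \<in> T x" using below[of 1] by (simp add: T_def)
  qed
  have "\<exists>X :: nat \<Rightarrow> 'a. \<forall>n. (X n \<in> S \<and> (n = 0 \<longrightarrow> X n = x0)) \<and>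
    (X (Suc n) \<in> T (X n) \<and> (\<forall>z\<in>T (X n). f (X (Suc n)) < f z + inverse (real (Suc n))))"
  proof (rule dependent_nat_choice)
    show "\<exists>x. x \<in> S \<and> (0 = 0 \<longrightarrow> x = x0)" using x0 by blast
  next
    fix x and n :: nat assume x: "x \<in> S \<and> (n = 0 \<longrightarrow> x = x0)"
    have ne: "f ` T x \<noteq> {}" and bb: "bdd_below (f ` T x)"
      using x T_self bdd by (auto simp: T_def intro!: bdd_belowI[of _ b])
    have "Inf (f ` T x) < Inf (f ` T x) + inverse (real (Suc n))" by simp
    then obtain y where y: "y \<in> T x" "f y < Inf (f ` T x) + inverse (real (Suc n))"
      unfolding cInf_less_iff[OF ne bb] by auto
    have "f y < f z + inverse (real (Suc n))" if "z \<in> T x" for z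
      using y(2) cInf_lower[OF _ bb, of "f z"] that by force
    then show "\<exists>y. (y \<in> S \<and> (Suc n = 0 \<longrightarrow> y = x0)) \<and>
      (y \<in> T x \<and> (\<forall>z\<in>T x. f y < f z + inverse (real (Suc n))))"
      using y(1) by (auto simp: T_def)
  qed
  then obtain X where X0: "X 0 = x0" and XS: "\<And>n. X n \<in> S" and XT: "\<And>n. X (Suc n) \<in> T (X n)"
    and Xmin: "\<And>n z. z \<in> T (X n) \<Longrightarrow> f (X (Suc n)) < f z + inverse (real (Suc n))"
    by metis
  have mono: "X n \<in> T (X m)" if "m \<le> n" for m n
    using that by (induction n rule: dec_induct) (auto intro: T_self XS T_trans XT)
  then have close: "\<epsilon> * dist (X m) (X n) \<le> f (X m) - f (X n)" if "m \<le> n" for m n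
    using that by (fastforce simp: T_def)
  have "decseq (\<lambda>n. f (X n))"
  proof (rule decseq_SucI)
    fix n
    have "0 \<le> \<epsilon> * dist (X n) (X (Suc n))" using eps by simp
    also note close[of n "Suc n"]
    finally show "f (X (Suc n)) \<le> f (X n)" by simp
  qed
  then obtain l where "(\<lambda>n. f (X n)) \<longlonglongrightarrow> l"
    using decseq_convergent[of "\<lambda>n. f (X n)" b] bdd XS by metis
  then have "Cauchy (\<lambda>n. f (X n))" by (rule LIMSEQ_imp_Cauchy)
  have "Cauchy X"
  proof (rule metric_CauchyI)
    fix e :: real assume "e > 0"
    then have "\<epsilon> * e > 0" using eps by simp
    then obtain M where M: "\<And>m n. m \<ge> M \<Longrightarrow> n \<ge> M \<Longrightarrow> dist (f (X m)) (f (X n)) < \<epsilon> * e"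
      using metric_CauchyD[OF \<open>Cauchy (\<lambda>n. f (X n))\<close>] by blast
    have wlog: "dist (X m) (X n) < e" if "m \<ge> M" "m \<le> n" for m n
    proof -
      have "\<epsilon> * dist (X m) (X n) < \<epsilon> * e"
        using close[OF that(2)] M[of m n] that by (auto simp: dist_real_def)
      then show ?thesis using eps by simp
    qed
    have "dist (X m) (X n) < e" if "m \<ge> M" "n \<ge> M" for m n
      using wlog[of m n] wlog[of n m] that by (cases "m \<le> n") (auto simp: dist_commute)
    then show "\<exists>M. \<forall>m\<ge>M. \<forall>n\<ge>M. dist (X m) (X n) < e" by blast
  qed
  then obtain x where x: "X \<longlonglongrightarrow> x" by (auto simp: Cauchy_convergent_iff convergent_def)
  have xT: "x \<in> T (X n)" for n
    by (rule Lim_in_closed_set[OF T_closed _ _ x])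
      (auto intro!: eventually_sequentiallyI[of n] mono)
  have xS: "x \<in> S" using xT by (auto simp: T_def)
  have min: "f x \<le> f y" if "y \<in> T x" for y
  proof -
    have "f x \<le> f y + inverse (real (Suc n))" for n
    proof -
      have "f x \<le> f (X (Suc n))"
      proof -
        have "f x + \<epsilon> * dist (X (Suc n)) x \<le> f (X (Suc n))" using xT by (simp add: T_def)
        moreover have "0 \<le> \<epsilon> * dist (X (Suc n)) x" using eps by simp
        ultimately show ?thesis by linarith
      qed
      also have "\<dots> < f y + inverse (real (Suc n))"
        by (rule Xmin[OF T_trans[OF xT that]])
      finally show ?thesis by simp
    qed
    moreover have "(\<lambda>n. f y + inverse (real (Suc n))) \<longlonglongrightarrow> f y + 0"
      by (intro tendsto_add tendsto_const LIMSEQ_inverse_real_of_nat)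
    ultimately show ?thesis using LIMSEQ_le_const by fastforce
  qed
  show thesis
  proof (rule that[OF xS])
    show "f x + \<epsilon> * dist x0 x \<le> f x0" using xT[of 0] X0 by (simp add: T_def)
    show "f x \<le> f y + \<epsilon> * dist x y" if "y \<in> S" for y
    proof (rule ccontr)
      assume neg: "\<not> f x \<le> f y + \<epsilon> * dist x y"
      then have "f x \<le> f y" using that by (intro min) (simp add: T_def)
      moreover have "0 \<le> \<epsilon> * dist x y" using eps by simp
      ultimately show False using neg by simp
    qed
  qed
qed

section \<open>Minima of functionals with the Palais-Smale property\<close>

text \<open>
  The derivative is a separate argument, since a functional and its derivative are given as a pair
  throughout. The values along the sequence need only be bounded, not convergent.
\<close>

definition palais_smale ::
  "('a::real_normed_vector \<Rightarrow> real) \<Rightarrow> ('a \<Rightarrow> 'a \<Rightarrow>\<^sub>L real) \<Rightarrow> bool" where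
  "palais_smale E E' \<longleftrightarrow> (\<forall>u. bounded (range (\<lambda>n. E (u n))) \<and> (\<lambda>n. E' (u n)) \<longlonglongrightarrow> 0
     \<longrightarrow> (\<exists>(s :: nat \<Rightarrow> nat) x. strict_mono s \<and> (\<lambda>n. u (s n)) \<longlonglongrightarrow> x))"

lemma C1_continuous:
  assumes "C1_with_derivative E E'"
  shows "isCont E x" "isCont E' x"
  using assms by (auto simp: C1_with_derivative_def continuous_on_eq_continuous_at
    intro: has_derivative_continuous)

lemma C1_mean_value:
  assumes "C1_with_derivative E E'"
  obtains s where "0 < s" "s < 1" "E (x + v) - E x = blinfun_apply (E' (x + s *\<^sub>R v)) v"
proof -
  have D: "((\<lambda>t. E (x + t *\<^sub>R v)) has_derivative
      (\<lambda>h. blinfun_apply (E' (x + t *\<^sub>R v)) (h *\<^sub>R v))) (at t within {0..1})" for t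
  proof -
    have 1: "((\<lambda>t. x + t *\<^sub>R v) has_derivative (\<lambda>h. h *\<^sub>R v)) (at t within {0..1})"
      by (auto intro!: derivative_eq_intros)
    have 2: "(E has_derivative blinfun_apply (E' (x + t *\<^sub>R v))) (at (x + t *\<^sub>R v))"
      using assms by (simp add: C1_with_derivative_def)
    show ?thesis by (rule has_derivative_compose[OF 1 2])
  qed
  have "\<exists>s\<in>{0<..<1}. E (x + 1 *\<^sub>R v) - E (x + 0 *\<^sub>R v) = blinfun_apply (E' (x + s *\<^sub>R v)) ((1 - 0) *\<^sub>R v)"
    by (rule mvt_simple) (use D in auto)
  then show thesis using that by auto
qed

lemma palais_smale_limit:
  assumes C1: "C1_with_derivative E E'" and ps: "palais_smale E E'"
    and "bounded (range (\<lambda>n. E (u n)))" and E': "(\<lambda>n. E' (u n)) \<longlonglongrightarrow> 0"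
  obtains s x where "strict_mono (s :: nat \<Rightarrow> nat)" "(\<lambda>n. u (s n)) \<longlonglongrightarrow> x"
    "(\<lambda>n. E (u (s n))) \<longlonglongrightarrow> E x" "E' x = 0"
proof -
  obtain s x where s: "strict_mono (s :: nat \<Rightarrow> nat)" and x: "(\<lambda>n. u (s n)) \<longlonglongrightarrow> x"
    using ps assms(3) E' unfolding palais_smale_def by blast
  have "(\<lambda>n. E' (u (s n))) \<longlonglongrightarrow> E' x"
    using isCont_tendsto_compose[OF C1_continuous(2)[OF C1] x] .
  moreover have "(\<lambda>n. E' (u (s n))) \<longlonglongrightarrow> 0"
    using LIMSEQ_subseq_LIMSEQ[OF E' s] by (simp add: o_def)
  ultimately have "E' x = 0" by (rule LIMSEQ_unique)
  moreover have "(\<lambda>n. E (u (s n))) \<longlonglongrightarrow> E x"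
    using isCont_tendsto_compose[OF C1_continuous(1)[OF C1] x] .
  ultimately show thesis using that s x by blast
qed

lemma norm_blinfun_le_if_lower_bound:
  fixes D :: "'a::real_normed_vector \<Rightarrow>\<^sub>L real"
  assumes eps: "0 \<le> \<epsilon>" and D: "\<And>v. norm v \<le> 1 \<Longrightarrow> - \<epsilon> \<le> blinfun_apply D v"
  shows "norm D \<le> \<epsilon>"
proof (rule norm_blinfun_bound[OF eps])
  fix v
  show "norm (blinfun_apply D v) \<le> \<epsilon> * norm v"
  proof (cases "v = 0")
    case False
    then have "- \<epsilon> \<le> blinfun_apply D (v /\<^sub>R norm v)" "- \<epsilon> \<le> blinfun_apply D (- (v /\<^sub>R norm v))"
      by (auto intro!: D)
    then have "\<bar>blinfun_apply D v / norm v\<bar> \<le> \<epsilon>"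
      by (simp add: blinfun.scaleR_right blinfun.minus_right divide_inverse mult.commute)
    then show ?thesis using False by (simp add: field_simps)
  qed simp
qed

text \<open>
  A point at which \<open>f\<close> plus \<open>\<epsilon>\<close> times the distance to the point is locally minimal has a
  derivative of norm at most \<open>\<epsilon>\<close>: compare the one-sided difference quotients in all directions.
\<close>

lemma almost_minimum_derivative_le:
  fixes D :: "'a::real_normed_vector \<Rightarrow>\<^sub>L real"
  assumes f: "(f has_derivative blinfun_apply D) (at x)" and eps: "0 \<le> \<epsilon>"
    and min: "\<forall>\<^sub>F y in nhds x. f x \<le> f y + \<epsilon> * dist x y"
  shows "norm D \<le> \<epsilon>"
proof (rule norm_blinfun_le_if_lower_bound[OF eps])
  fix v :: 'a assume v: "norm v \<le> 1"
  have "((\<lambda>t. f (x + t *\<^sub>R v)) has_derivative (\<lambda>h. blinfun_apply D (h *\<^sub>R v))) (at 0)"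
  proof -
    have "((\<lambda>t. x + t *\<^sub>R v) has_derivative (\<lambda>h. h *\<^sub>R v)) (at 0)"
      by (auto intro!: derivative_eq_intros)
    from has_derivative_compose[OF this, of f "blinfun_apply D"] f show ?thesis by simp
  qed
  then have "((\<lambda>t. f (x + t *\<^sub>R v)) has_field_derivative blinfun_apply D v) (at 0)"
    by (simp add: has_field_derivative_def blinfun.scaleR_right mult_commute_abs)
  then have "((\<lambda>t. (f (x + t *\<^sub>R v) - f x) / t) \<longlongrightarrow> blinfun_apply D v) (at 0)"
    by (simp add: has_field_derivative_iff)
  then have lim: "((\<lambda>t. (f (x + t *\<^sub>R v) - f x) / t) \<longlongrightarrow> blinfun_apply D v) (at_right 0)"
    by (simp add: filterlim_at_split)
  have "((\<lambda>t. x + t *\<^sub>R v) \<longlongrightarrow> x + 0 *\<^sub>R v) (at_right 0)"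
    by (intro tendsto_intros)
  then have "\<forall>\<^sub>F t in at_right 0. f x \<le> f (x + t *\<^sub>R v) + \<epsilon> * dist x (x + t *\<^sub>R v)"
    using min by (auto simp: filterlim_iff)
  then have "\<forall>\<^sub>F t in at_right 0. - \<epsilon> \<le> (f (x + t *\<^sub>R v) - f x) / t"
    using eventually_at_right_less[of "0::real"]
  proof eventually_elim
    case (elim t)
    have "\<epsilon> * (t * norm v) \<le> \<epsilon> * (t * 1)"
      using v eps elim(2) by (intro mult_left_mono) auto
    then show ?case using elim by (simp add: dist_norm field_simps)
  qed
  then show "- \<epsilon> \<le> blinfun_apply D v"
    by (intro tendsto_lowerbound[OF lim]) auto
qed

text \<open>
  The variational principle gives a minimizing sequence in \<open>S\<close> whose members minimize up to a small
  multiple of the distance. The condition on the points below the level \<open>E x0\<close> keeps the sequence in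
  the interior of \<open>S\<close>, so the derivatives tend to zero and the Palais-Smale property makes a
  subsequence converge to the minimum. With \<open>S = UNIV\<close> this gives global minima, and with a
  sublevel set surrounded by higher values it gives local ones.
\<close>

proposition minimum_critical:
  fixes E :: "'a::banach \<Rightarrow> real"
  assumes C1: "C1_with_derivative E E'" and ps: "palais_smale E E'"
    and S: "closed S" "x0 \<in> S" and bdd: "\<And>x. x \<in> S \<Longrightarrow> b \<le> E x"
    and wall: "\<And>x. x \<in> S \<Longrightarrow> E x \<le> E x0 \<Longrightarrow> x \<in> interior S"
  obtains x where "x \<in> S" "E' x = 0" "\<And>y. y \<in> S \<Longrightarrow> E x \<le> E y"
proof -
  define i where "i = Inf (E ` S)"
  have ne: "E ` S \<noteq> {}" and bb: "bdd_below (E ` S)"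
    using S bdd by (auto intro!: bdd_belowI[of _ b])
  have i_le: "i \<le> E y" if "y \<in> S" for y
    unfolding i_def using that bb by (auto intro: cInf_lower)
  have "\<exists>x\<in>S. E x \<le> i + inverse (real (Suc n)) \<and> norm (E' x) \<le> inverse (real (Suc n))" for n
  proof -
    define \<epsilon> where "\<epsilon> = inverse (real (Suc n))"
    have "\<epsilon> > 0" by (simp add: \<epsilon>_def)
    then have "Inf (E ` S) < i + \<epsilon>" by (simp add: i_def)
    then obtain y' where "y' \<in> S" "E y' < i + \<epsilon>"
      unfolding cInf_less_iff[OF ne bb] by auto
    (* Start below the level of x0, so that the point found by the variational principle is interior. *)
    then obtain y where y: "y \<in> S" "E y < i + \<epsilon>" "E y \<le> E x0"
      using S(2) by (cases "E y' \<le> E x0") auto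
    have lsc: "closed {x \<in> S. E x \<le> a}" for a
      using S(1) C1_continuous(1)[OF C1]
      by (auto intro!: closed_Collect_conj closed_Collect_le continuous_at_imp_continuous_on)
    obtain x where x: "x \<in> S" "E x + \<epsilon> * dist y x \<le> E y" "\<And>z. z \<in> S \<Longrightarrow> E x \<le> E z + \<epsilon> * dist x z"
      using Ekeland_variational_principle[OF y(1) bdd lsc \<open>\<epsilon> > 0\<close>] by blast
    have "0 \<le> \<epsilon> * dist y x" using \<open>\<epsilon> > 0\<close> by simp
    then have "E x \<le> E y" using x(2) by linarith
    then have "x \<in> interior S" using wall x(1) y(3) by simp
    then have "\<forall>\<^sub>F z in nhds x. z \<in> S"
      unfolding eventually_nhds using interior_subset[of S] by (intro exI[of _ "interior S"]) auto
    then have "\<forall>\<^sub>F z in nhds x. E x \<le> E z + \<epsilon> * dist x z"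
      by eventually_elim (rule x(3))
    then have "norm (E' x) \<le> \<epsilon>"
      using C1 \<open>\<epsilon> > 0\<close> by (intro almost_minimum_derivative_le[of E]) (auto simp: C1_with_derivative_def)
    moreover have "E x \<le> i + \<epsilon>" using \<open>E x \<le> E y\<close> y(2) by linarith
    ultimately show ?thesis using x(1) unfolding \<epsilon>_def by blast
  qed
  then obtain u where u: "\<And>n. u n \<in> S" "\<And>n. E (u n) \<le> i + inverse (real (Suc n))"
    "\<And>n. norm (E' (u n)) \<le> inverse (real (Suc n))" by metis
  have E': "(\<lambda>n. E' (u n)) \<longlonglongrightarrow> 0"
    by (rule Lim_null_comparison[OF always_eventually[OF allI[OF u(3)]] LIMSEQ_inverse_real_of_nat])
  have "(\<lambda>n. i + inverse (real (Suc n))) \<longlonglongrightarrow> i + 0"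
    by (intro tendsto_add tendsto_const LIMSEQ_inverse_real_of_nat)
  then have upper: "(\<lambda>n. i + inverse (real (Suc n))) \<longlonglongrightarrow> i" by simp
  have lim: "(\<lambda>n. E (u n)) \<longlonglongrightarrow> i"
    by (rule tendsto_sandwich[OF _ _ tendsto_const upper];
        intro always_eventually allI i_le u(1) u(2))
  obtain s x where s: "strict_mono (s :: nat \<Rightarrow> nat)" "(\<lambda>n. u (s n)) \<longlonglongrightarrow> x"
    "(\<lambda>n. E (u (s n))) \<longlonglongrightarrow> E x" "E' x = 0"
    using palais_smale_limit[OF C1 ps convergent_imp_bounded[OF lim] E'] .
  have "E x = i"
    using LIMSEQ_unique[OF s(3)] LIMSEQ_subseq_LIMSEQ[OF lim s(1)] by (simp add: o_def)
  moreover have "x \<in> S"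
    using closed_sequentially[OF S(1) _ s(2)] u(1) by blast
  ultimately show thesis using that s(4) i_le by metis
qed

section \<open>The mountain pass theorem\<close>

text \<open>
  Paths are bounded continuous functions on the whole line, of which only the restriction to the unit
  interval matters. This makes the space of paths a complete metric space under the uniform distance.
\<close>

definition path_height :: "('a::metric_space \<Rightarrow> real) \<Rightarrow> (real \<Rightarrow>\<^sub>C 'a) \<Rightarrow> real" where
  "path_height E \<gamma> = (SUP t\<in>{0..1}. E (apply_bcontfun \<gamma> t))"

lemma path_height_maximum:
  assumes "continuous_on UNIV E"
  shows "\<exists>t\<in>{0..1}. E (apply_bcontfun \<gamma> t) = path_height E \<gamma> \<and>
    (\<forall>s\<in>{0..1}. E (apply_bcontfun \<gamma> s) \<le> path_height E \<gamma>)"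
proof -
  have "continuous_on {0..1} (\<lambda>t. E (apply_bcontfun \<gamma> t))"
    by (rule continuous_on_compose2[OF assms]) auto
  then obtain t :: real where t: "t \<in> {0..1}"
    "\<And>s. s \<in> {0..1} \<Longrightarrow> E (apply_bcontfun \<gamma> s) \<le> E (apply_bcontfun \<gamma> t)"
    using continuous_attains_sup[of "{0..1::real}" "\<lambda>t. E (apply_bcontfun \<gamma> t)"] by auto
  then have "path_height E \<gamma> = E (apply_bcontfun \<gamma> t)"
    unfolding path_height_def by (intro cSup_eq_maximum) auto
  then show ?thesis using t by auto
qed

lemma path_height_attained:
  assumes "continuous_on UNIV E"
  shows "\<exists>t\<in>{0..1}. E (apply_bcontfun \<gamma> t) = path_height E \<gamma>"
  using path_height_maximum[OF assms] by blast

lemma path_height_upper: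
  assumes "continuous_on UNIV E" "t \<in> {0..1}"
  shows "E (apply_bcontfun \<gamma> t) \<le> path_height E \<gamma>"
  using path_height_maximum[OF assms(1)] assms(2) by blast

lemma path_height_le_iff:
  assumes "continuous_on UNIV E"
  shows "path_height E \<gamma> \<le> c \<longleftrightarrow> (\<forall>t\<in>{0..1}. E (apply_bcontfun \<gamma> t) \<le> c)"
  using path_height_maximum[OF assms, of \<gamma>] by fastforce

lemma continuous_on_eval_bcontfun:
  "continuous_on UNIV (\<lambda>\<gamma> :: 'b::topological_space \<Rightarrow>\<^sub>C 'a::metric_space. apply_bcontfun \<gamma> t)"
  unfolding continuous_on_iff using dist_fun_lt_imp_dist_val_lt by blast

text \<open>
  At each \<open>t \<in> T\<close> there is a direction of norm at most one in which \<open>E\<close> decreases at a rate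
  above \<open>\<epsilon>\<close>, and by continuity it works for nearby parameters too. Finitely many of these
  directions \<open>V i\<close> suffice. They are combined with weights \<open>f i\<close> that are positive only where
  \<open>V i\<close> is a good direction and only above the level \<open>\<kappa>\<close>; this makes the field continuous
  and zero below that level.
\<close>

lemma pseudo_gradient_along_path:
  fixes \<gamma> :: "real \<Rightarrow>\<^sub>C 'a::real_normed_vector"
  assumes C1: "C1_with_derivative E E'" and T: "compact T" "T \<noteq> {}"
    and E: "\<And>t. t \<in> T \<Longrightarrow> \<kappa> < E (apply_bcontfun \<gamma> t)"
    and E': "\<And>t. t \<in> T \<Longrightarrow> \<epsilon> < norm (E' (apply_bcontfun \<gamma> t))" and eps: "0 \<le> \<epsilon>"
  obtains v where "continuous_on UNIV v" "\<And>t. norm (v t) \<le> 1"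
    "\<And>t. E (apply_bcontfun \<gamma> t) \<le> \<kappa> \<Longrightarrow> v t = 0"
    "\<And>t. t \<in> T \<Longrightarrow> blinfun_apply (E' (apply_bcontfun \<gamma> t)) (v t) < - \<epsilon>"
proof -
  have "continuous_on UNIV E" "continuous_on UNIV E'"
    using C1_continuous[OF C1] by (auto simp: continuous_on_eq_continuous_at)
  then have cE: "continuous_on UNIV (\<lambda>t. E (apply_bcontfun \<gamma> t))"
    and cE': "continuous_on UNIV (\<lambda>t. E' (apply_bcontfun \<gamma> t))"
    by (auto intro: continuous_on_compose2)
  have "\<exists>v. norm v \<le> 1 \<and> blinfun_apply (E' (apply_bcontfun \<gamma> t)) v < - \<epsilon>" if "t \<in> T" for t
    using norm_blinfun_le_if_lower_bound[OF eps, of "E' (apply_bcontfun \<gamma> t)"] E'[OF that]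
    by (meson not_less)
  then obtain V where V: "\<And>t. t \<in> T \<Longrightarrow> norm (V t) \<le> 1"
    "\<And>t. t \<in> T \<Longrightarrow> blinfun_apply (E' (apply_bcontfun \<gamma> t)) (V t) < - \<epsilon>" by metis
  define U where "U i = {t. blinfun_apply (E' (apply_bcontfun \<gamma> t)) (V i) < - \<epsilon>}" for i
  have "open (U i)" for i
    unfolding U_def by (intro open_Collect_less continuous_intros cE')
  moreover have "T \<subseteq> (\<Union>i\<in>T. U i)" using V(2) by (auto simp: U_def)
  ultimately obtain I where I: "I \<subseteq> T" "finite I" "T \<subseteq> (\<Union>i\<in>I. U i)"
    using compactE_image[OF T(1)] by metis
  define f where "f i t = max 0 (- \<epsilon> - blinfun_apply (E' (apply_bcontfun \<gamma> t)) (V i)) *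
    max 0 (E (apply_bcontfun \<gamma> t) - \<kappa>)" for i t
  define \<sigma> where "\<sigma> t = (\<Sum>i\<in>I. f i t)" for t
  define w where "w t = (\<Sum>i\<in>I. f i t *\<^sub>R V i)" for t
  have f0: "f i t \<ge> 0" for i t by (simp add: f_def)
  have cf: "continuous_on UNIV (f i)" for i
    unfolding f_def by (intro continuous_intros cE cE')
  have c\<sigma>: "continuous_on UNIV \<sigma>" and cw: "continuous_on UNIV w"
    unfolding \<sigma>_def w_def by (intro continuous_intros cf)+
  have \<sigma>0: "\<sigma> t \<ge> 0" for t unfolding \<sigma>_def by (simp add: sum_nonneg f0)
  have w_le: "norm (w t) \<le> \<sigma> t" for t
  proof -
    have "norm (w t) \<le> (\<Sum>i\<in>I. norm (f i t *\<^sub>R V i))" unfolding w_def by (rule norm_sum)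
    also have "\<dots> \<le> \<sigma> t"
      unfolding \<sigma>_def
    proof (rule sum_mono)
      fix i assume "i \<in> I"
      then have "f i t * norm (V i) \<le> f i t * 1"
        using V(1) I(1) f0 by (intro mult_left_mono) auto
      then show "norm (f i t *\<^sub>R V i) \<le> f i t" using f0 by simp
    qed
    finally show ?thesis .
  qed
  have on_T: "\<sigma> t > 0 \<and> blinfun_apply (E' (apply_bcontfun \<gamma> t)) (w t) < - \<epsilon> * \<sigma> t" if t: "t \<in> T" for t
  proof -
    define D where "D i = blinfun_apply (E' (apply_bcontfun \<gamma> t)) (V i)" for i
    obtain j where j: "j \<in> I" "D j < - \<epsilon>" using I(3) t by (auto simp: U_def D_def)
    have "f j t > 0" using j(2) E[OF t] by (auto simp: f_def D_def intro!: mult_pos_pos)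
    then have "\<sigma> t > 0" unfolding \<sigma>_def using I(2) j(1) f0 by (intro sum_pos2[of _ j]) auto
    have le: "f i t * D i \<le> - \<epsilon> * f i t" for i
    proof (cases "D i < - \<epsilon>")
      case True
      then have "f i t * D i \<le> f i t * - \<epsilon>" using f0 by (intro mult_left_mono) auto
      then show ?thesis by (simp add: mult.commute)
    next
      case False
      then show ?thesis by (simp add: f_def D_def)
    qed
    have less: "f j t * D j < - \<epsilon> * f j t"
      using mult_strict_left_mono[OF j(2) \<open>f j t > 0\<close>] by (simp add: mult.commute)
    have "blinfun_apply (E' (apply_bcontfun \<gamma> t)) (w t) = (\<Sum>i\<in>I. f i t * D i)"
      by (simp add: w_def D_def blinfun.sum_right blinfun.scaleR_right)
    also have "\<dots> < (\<Sum>i\<in>I. - \<epsilon> * f i t)"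
      using I(2) j(1) le less by (intro sum_strict_mono_ex1) auto
    also have "\<dots> = - \<epsilon> * \<sigma> t" unfolding \<sigma>_def by (simp add: sum_distrib_left)
    finally show ?thesis using \<open>\<sigma> t > 0\<close> by simp
  qed
  obtain t0 where t0: "t0 \<in> T" "\<And>t. t \<in> T \<Longrightarrow> \<sigma> t0 \<le> \<sigma> t"
    using continuous_attains_inf[OF T continuous_on_subset[OF c\<sigma>]] by auto
  define \<delta> where "\<delta> = \<sigma> t0"
  have "\<delta> > 0" using on_T[OF t0(1)] by (simp add: \<delta>_def)
  (* Dividing by the sum of the weights normalises the field on T; the lower bound of this sum over T
     keeps the quotient continuous and of norm at most one elsewhere. *)
  define v where "v t = w t /\<^sub>R max \<delta> (\<sigma> t)" for t
  show thesis
  proof (rule that)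
    show "continuous_on UNIV v"
      unfolding v_def using \<open>\<delta> > 0\<close> by (intro continuous_intros cw c\<sigma>) (auto simp: max_def)
    show "norm (v t) \<le> 1" for t
      using w_le[of t] \<open>\<delta> > 0\<close> by (simp add: v_def divide_simps max_def)
    show "v t = 0" if "E (apply_bcontfun \<gamma> t) \<le> \<kappa>" for t
      using that by (simp add: v_def w_def f_def max_def)
    show "blinfun_apply (E' (apply_bcontfun \<gamma> t)) (v t) < - \<epsilon>" if t: "t \<in> T" for t
    proof -
      have "max \<delta> (\<sigma> t) = \<sigma> t" using t0(2)[OF t] by (simp add: \<delta>_def)
      then show ?thesis
        using on_T[OF t] by (simp add: v_def blinfun.scaleR_right field_simps)
    qed
  qed
qed

text \<open>
  Otherwise the derivative has norm above \<open>\<epsilon>\<close> at every highest point of the path. Moving the path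
  by \<open>d n\<close> times a pseudo-gradient field lowers its height by at most \<open>\<epsilon> * d n\<close>, so some point of
  the moved path is at most \<open>\<epsilon> * d n\<close> below the old height. As \<open>d n\<close> tends to zero, the parameters
  of these points accumulate at a highest point of the original path, where by the mean value theorem
  the rate of decrease would be at most \<open>\<epsilon>\<close>.
\<close>

lemma almost_minimal_path_almost_critical:
  fixes \<gamma> :: "real \<Rightarrow>\<^sub>C 'a::real_normed_vector"
  assumes C1: "C1_with_derivative E E'" and eps: "0 \<le> \<epsilon>"
    and ends: "E (apply_bcontfun \<gamma> 0) < path_height E \<gamma>" "E (apply_bcontfun \<gamma> 1) < path_height E \<gamma>"
    and min: "\<And>\<eta>. apply_bcontfun \<eta> 0 = apply_bcontfun \<gamma> 0 \<Longrightarrow> apply_bcontfun \<eta> 1 = apply_bcontfun \<gamma> 1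
      \<Longrightarrow> path_height E \<gamma> \<le> path_height E \<eta> + \<epsilon> * dist \<gamma> \<eta>"
  shows "\<exists>t\<in>{0..1}. E (apply_bcontfun \<gamma> t) = path_height E \<gamma> \<and> norm (E' (apply_bcontfun \<gamma> t)) \<le> \<epsilon>"
proof (rule ccontr)
  assume no: "\<not> ?thesis"
  define h where "h = path_height E \<gamma>"
  define g where "g = apply_bcontfun \<gamma>"
  have cg: "continuous_on UNIV g" by (simp add: g_def)
  have cE: "continuous_on UNIV E"
    using C1_continuous(1)[OF C1] by (simp add: continuous_on_eq_continuous_at)
  have cEg: "continuous_on UNIV (\<lambda>t. E (g t))"
    using continuous_on_compose2[OF cE cg] by simp
  define T where "T = {0..1} \<inter> {t. E (g t) = h}"
  have "compact T" unfolding T_def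
    by (intro compact_Int_closed closed_Collect_eq cEg continuous_intros) auto
  moreover have "T \<noteq> {}"
    using path_height_attained[OF cE, of \<gamma>] by (auto simp: T_def g_def h_def)
  moreover have "\<epsilon> < norm (E' (g t))" if "t \<in> T" for t
    using no that by (auto simp: T_def g_def h_def)
  moreover have "max (E (g 0)) (E (g 1)) < E (g t)" if "t \<in> T" for t
    using ends that by (auto simp: T_def g_def h_def)
  ultimately obtain v where cv: "continuous_on UNIV v" and v1: "\<And>t. norm (v t) \<le> 1"
    and v0: "\<And>t. E (g t) \<le> max (E (g 0)) (E (g 1)) \<Longrightarrow> v t = 0"
    and vT: "\<And>t. t \<in> T \<Longrightarrow> blinfun_apply (E' (g t)) (v t) < - \<epsilon>"
    using pseudo_gradient_along_path[OF C1, of T "max (E (g 0)) (E (g 1))" \<gamma> \<epsilon>] eps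
    unfolding g_def by blast
  have step: "\<exists>t\<in>{0..1}. \<exists>s. 0 < s \<and> s < 1 \<and> h \<le> E (g t + d *\<^sub>R v t) + \<epsilon> * d \<and>
      - \<epsilon> \<le> blinfun_apply (E' (g t + (s * d) *\<^sub>R v t)) (v t)" if d: "d > 0" for d
  proof -
    define \<eta> where "\<eta> = Bcontfun (\<lambda>t. g t + d *\<^sub>R v t)"
    have "bounded (range v)" using v1 by (auto simp: bounded_iff)
    then have "bounded (range (\<lambda>t. d *\<^sub>R v t))" by (rule bounded_scaleR_comp)
    then have "(\<lambda>t. g t + d *\<^sub>R v t) \<in> bcontfun"
      unfolding bcontfun_def by (auto intro!: continuous_intros cv cg bounded_plus_comp simp: g_def)
    then have \<eta>: "apply_bcontfun \<eta> t = g t + d *\<^sub>R v t" for t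
      by (simp add: \<eta>_def Bcontfun_inverse)
    have "dist \<gamma> \<eta> \<le> d"
    proof (rule dist_bound)
      fix t
      have "d * norm (v t) \<le> d * 1" using v1 d by (intro mult_left_mono) auto
      then show "dist (apply_bcontfun \<gamma> t) (apply_bcontfun \<eta> t) \<le> d"
        using d by (simp add: \<eta> g_def dist_norm)
    qed
    then have "\<epsilon> * dist \<gamma> \<eta> \<le> \<epsilon> * d" using eps by (rule mult_left_mono)
    moreover have "h \<le> path_height E \<eta> + \<epsilon> * dist \<gamma> \<eta>"
      unfolding h_def by (rule min) (auto simp: \<eta> v0 g_def[symmetric])
    moreover obtain t where t: "t \<in> {0..1}" "E (apply_bcontfun \<eta> t) = path_height E \<eta>"
      using path_height_attained[OF cE, of \<eta>] by blast
    ultimately have ge: "h \<le> E (g t + d *\<^sub>R v t) + \<epsilon> * d" by (simp add: \<eta>)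
    have "E (g t) \<le> h" using path_height_upper[OF cE t(1), of \<gamma>] by (auto simp: h_def g_def)
    obtain s where s: "0 < s" "s < 1"
      "E (g t + d *\<^sub>R v t) - E (g t) = blinfun_apply (E' (g t + s *\<^sub>R (d *\<^sub>R v t))) (d *\<^sub>R v t)"
      using C1_mean_value[OF C1] by blast
    have "d * (- \<epsilon>) \<le> E (g t + d *\<^sub>R v t) - E (g t)"
      using ge \<open>E (g t) \<le> h\<close> by (simp add: algebra_simps)
    also have "\<dots> = d * blinfun_apply (E' (g t + (s * d) *\<^sub>R v t)) (v t)"
      using s(3) by (simp add: blinfun.scaleR_right)
    finally have "- \<epsilon> \<le> blinfun_apply (E' (g t + (s * d) *\<^sub>R v t)) (v t)"
      using d by (rule mult_left_le_imp_le)
    with t s ge show ?thesis by blast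
  qed
  define d where "d n = inverse (real (Suc n))" for n
  have d0: "d n > 0" for n by (simp add: d_def)
  have d_lim: "d \<longlonglongrightarrow> 0" unfolding d_def by (rule LIMSEQ_inverse_real_of_nat)
  have "\<forall>n. \<exists>t s. t \<in> {0..1} \<and> 0 < s \<and> s < 1 \<and> h \<le> E (g t + d n *\<^sub>R v t) + \<epsilon> * d n \<and>
      - \<epsilon> \<le> blinfun_apply (E' (g t + (s * d n) *\<^sub>R v t)) (v t)"
    using step[OF d0] by blast
  then obtain t s where ts: "\<And>n. t n \<in> {0..1}" "\<And>n. 0 < s n" "\<And>n. s n < 1"
    "\<And>n. h \<le> E (g (t n) + d n *\<^sub>R v (t n)) + \<epsilon> * d n"
    "\<And>n. - \<epsilon> \<le> blinfun_apply (E' (g (t n) + (s n * d n) *\<^sub>R v (t n))) (v (t n))"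
    by metis
  have "\<forall>n. t n \<in> {0..1}" using ts(1) by blast
  then obtain t0 q where t0: "t0 \<in> {0..1}" and q: "strict_mono (q :: nat \<Rightarrow> nat)"
    and tq: "(t \<circ> q) \<longlonglongrightarrow> t0"
    using compact_imp_seq_compact[OF compact_Icc, of "0::real" 1] seq_compactE by metis
  have tq: "(\<lambda>n. t (q n)) \<longlonglongrightarrow> t0" using tq by (simp add: o_def)
  have dq: "(\<lambda>n. d (q n)) \<longlonglongrightarrow> 0"
    using LIMSEQ_subseq_LIMSEQ[OF d_lim q] by (simp add: o_def)
  have sdq: "(\<lambda>n. s (q n) * d (q n)) \<longlonglongrightarrow> 0"
  proof (rule Lim_null_comparison[OF _ dq], intro always_eventually allI)
    fix n
    have "s (q n) * d (q n) \<le> 1 * d (q n)"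
      using ts(3) d0 by (intro mult_right_mono less_imp_le)
    then show "norm (s (q n) * d (q n)) \<le> d (q n)"
      using ts(2)[of "q n"] d0[of "q n"] by simp
  qed
  have vq: "(\<lambda>n. v (t (q n))) \<longlonglongrightarrow> v t0" and gq: "(\<lambda>n. g (t (q n))) \<longlonglongrightarrow> g t0"
    using cv cg tq by (auto intro: continuous_on_tendsto_compose)
  have "(\<lambda>n. g (t (q n)) + d (q n) *\<^sub>R v (t (q n))) \<longlonglongrightarrow> g t0 + 0 *\<^sub>R v t0"
    by (intro tendsto_intros gq vq dq)
  then have "(\<lambda>n. E (g (t (q n)) + d (q n) *\<^sub>R v (t (q n))) + \<epsilon> * d (q n)) \<longlonglongrightarrow> E (g t0) + \<epsilon> * 0"
    using isCont_tendsto_compose[OF C1_continuous(1)[OF C1]]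
    by (intro tendsto_intros dq) simp
  then have "h \<le> E (g t0)"
    using LIMSEQ_le_const[of _ "E (g t0)" h] ts(4) by auto
  moreover have "E (g t0) \<le> h"
    using path_height_upper[OF cE t0, of \<gamma>] by (auto simp: h_def g_def)
  ultimately have "t0 \<in> T" using t0 by (simp add: T_def)
  have "(\<lambda>n. g (t (q n)) + (s (q n) * d (q n)) *\<^sub>R v (t (q n))) \<longlonglongrightarrow> g t0 + 0 *\<^sub>R v t0"
    by (intro tendsto_intros gq vq sdq)
  then have "(\<lambda>n. E' (g (t (q n)) + (s (q n) * d (q n)) *\<^sub>R v (t (q n)))) \<longlonglongrightarrow> E' (g t0)"
    using isCont_tendsto_compose[OF C1_continuous(2)[OF C1]] by simp
  then have "(\<lambda>n. blinfun_apply (E' (g (t (q n)) + (s (q n) * d (q n)) *\<^sub>R v (t (q n)))) (v (t (q n))))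
      \<longlonglongrightarrow> blinfun_apply (E' (g t0)) (v t0)"
    by (intro tendsto_intros vq)
  then have "- \<epsilon> \<le> blinfun_apply (E' (g t0)) (v t0)"
    by (rule LIMSEQ_le_const) (use ts(5) in blast)
  then show False using vT[OF \<open>t0 \<in> T\<close>] by simp
qed

text \<open>
  The height of a path is lower semicontinuous and at least \<open>\<rho>\<close> on the complete space of paths from
  \<open>a\<close> to \<open>b\<close>. The variational principle yields almost minimal paths, and these have points of
  height at least \<open>\<rho>\<close>, and at most the height of an initial path, with arbitrarily small derivative.
  By the Palais-Smale property they accumulate at a critical point.
\<close>

theorem mountain_pass:
  fixes E :: "'a::banach \<Rightarrow> real"
  assumes C1: "C1_with_derivative E E'" and ps: "palais_smale E E'"
    and ends: "E a < \<rho>" "E b < \<rho>"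
    and wall: "\<And>p :: real \<Rightarrow> 'a. continuous_on {0..1} p \<Longrightarrow> p 0 = a \<Longrightarrow> p 1 = b
      \<Longrightarrow> \<exists>t\<in>{0..1}. \<rho> \<le> E (p t)"
  obtains x where "E' x = 0" "\<rho> \<le> E x"
proof -
  have cE: "continuous_on UNIV E"
    using C1_continuous(1)[OF C1] by (simp add: continuous_on_eq_continuous_at)
  define \<Gamma> where "\<Gamma> = {\<gamma> :: real \<Rightarrow>\<^sub>C 'a. apply_bcontfun \<gamma> 0 = a \<and> apply_bcontfun \<gamma> 1 = b}"
  define c where "c t = a + max 0 (min 1 t) *\<^sub>R (b - a)" for t :: real
  have "norm (c t) \<le> norm a + norm (b - a)" for t
  proof -
    have "norm (c t) \<le> norm a + norm (max 0 (min 1 t) *\<^sub>R (b - a))"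
      unfolding c_def by (rule norm_triangle_ineq)
    also have "norm (max 0 (min 1 t) *\<^sub>R (b - a)) \<le> 1 * norm (b - a)"
      unfolding norm_scaleR by (intro mult_right_mono) (auto simp: max_def min_def)
    finally show ?thesis by simp
  qed
  moreover have "continuous_on UNIV c" unfolding c_def by (intro continuous_intros)
  ultimately have "c \<in> bcontfun" by (auto simp: bcontfun_def bounded_iff)
  then have "Bcontfun c \<in> \<Gamma>" by (simp add: \<Gamma>_def Bcontfun_inverse c_def)
  then obtain \<gamma>\<^sub>0 where \<gamma>0: "\<gamma>\<^sub>0 \<in> \<Gamma>" by blast
  have height: "\<rho> \<le> path_height E \<gamma>" if "\<gamma> \<in> \<Gamma>" for \<gamma>
  proof -
    obtain t where "t \<in> {0..1}" "\<rho> \<le> E (apply_bcontfun \<gamma> t)"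
      using wall[of "apply_bcontfun \<gamma>"] \<open>\<gamma> \<in> \<Gamma>\<close> by (auto simp: \<Gamma>_def)
    then show ?thesis using path_height_upper[OF cE, of t \<gamma>] by linarith
  qed
  have lsc: "closed {\<gamma> \<in> \<Gamma>. path_height E \<gamma> \<le> c}" for c
  proof -
    have "continuous_on UNIV (\<lambda>\<gamma> :: real \<Rightarrow>\<^sub>C 'a. E (apply_bcontfun \<gamma> t))" for t
      by (rule continuous_on_compose2[OF cE continuous_on_eval_bcontfun]) auto
    then have "closed ({\<gamma>. apply_bcontfun \<gamma> 0 = a} \<inter> {\<gamma>. apply_bcontfun \<gamma> 1 = b} \<inter>
        (\<Inter>t\<in>{0..1}. {\<gamma> :: real \<Rightarrow>\<^sub>C 'a. E (apply_bcontfun \<gamma> t) \<le> c}))"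
      by (intro closed_Int closed_INT ballI closed_Collect_eq closed_Collect_le
        continuous_on_eval_bcontfun continuous_on_const)
    also have "\<dots> = {\<gamma> \<in> \<Gamma>. path_height E \<gamma> \<le> c}"
      by (auto simp: \<Gamma>_def path_height_le_iff[OF cE])
    finally show ?thesis .
  qed
  have "\<exists>x. \<rho> \<le> E x \<and> E x \<le> path_height E \<gamma>\<^sub>0 \<and> norm (E' x) \<le> inverse (real (Suc n))" for n
  proof -
    define \<epsilon> where "\<epsilon> = inverse (real (Suc n))"
    have "\<epsilon> > 0" by (simp add: \<epsilon>_def)
    obtain \<gamma> where \<gamma>: "\<gamma> \<in> \<Gamma>" "path_height E \<gamma> + \<epsilon> * dist \<gamma>\<^sub>0 \<gamma> \<le> path_height E \<gamma>\<^sub>0"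
      "\<And>\<eta>. \<eta> \<in> \<Gamma> \<Longrightarrow> path_height E \<gamma> \<le> path_height E \<eta> + \<epsilon> * dist \<gamma> \<eta>"
      using Ekeland_variational_principle[OF \<gamma>0 height lsc \<open>\<epsilon> > 0\<close>] by blast
    have "\<exists>t\<in>{0..1}. E (apply_bcontfun \<gamma> t) = path_height E \<gamma> \<and> norm (E' (apply_bcontfun \<gamma> t)) \<le> \<epsilon>"
    proof (rule almost_minimal_path_almost_critical[OF C1])
      show "E (apply_bcontfun \<gamma> 0) < path_height E \<gamma>" "E (apply_bcontfun \<gamma> 1) < path_height E \<gamma>"
        using \<gamma>(1) height[OF \<gamma>(1)] ends by (auto simp: \<Gamma>_def)
    qed (use \<gamma> \<open>\<epsilon> > 0\<close> in \<open>auto simp: \<Gamma>_def\<close>)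
    moreover have "path_height E \<gamma> \<le> path_height E \<gamma>\<^sub>0"
    proof -
      have "0 \<le> \<epsilon> * dist \<gamma>\<^sub>0 \<gamma>" using \<open>\<epsilon> > 0\<close> by simp
      then show ?thesis using \<gamma>(2) by linarith
    qed
    ultimately show ?thesis using height[OF \<gamma>(1)] unfolding \<epsilon>_def by metis
  qed
  then obtain u where u: "\<And>n. \<rho> \<le> E (u n)" "\<And>n. E (u n) \<le> path_height E \<gamma>\<^sub>0"
    "\<And>n. norm (E' (u n)) \<le> inverse (real (Suc n))" by metis
  have E': "(\<lambda>n. E' (u n)) \<longlonglongrightarrow> 0"
    by (rule Lim_null_comparison[OF always_eventually[OF allI[OF u(3)]] LIMSEQ_inverse_real_of_nat])
  have "range (\<lambda>n. E (u n)) \<subseteq> {\<rho>..path_height E \<gamma>\<^sub>0}" using u by auto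
  then have bdd: "bounded (range (\<lambda>n. E (u n)))" by (rule bounded_subset[OF bounded_closed_interval])
  obtain s x where s: "(\<lambda>n. E (u (s n))) \<longlonglongrightarrow> E x" "E' x = 0"
    using palais_smale_limit[OF C1 ps bdd E'] by metis
  have "\<rho> \<le> E x" by (rule LIMSEQ_le_const[OF s(1)]) (use u(1) in blast)
  then show thesis using that s(2) by blast
qed

section \<open>Compact perturbations of coercive functionals and three critical points\<close>

text \<open>
  The derivative is bounded on balls, so the mean value theorem applies between the origin and a point
  of the bounded set.
\<close>

lemma bounded_image_compact_derivative:
  assumes C1: "C1_with_derivative J J'" and J': "compact_operator J'" and S: "bounded S"
  shows "bounded (J ` S)"
proof -
  obtain R where R: "\<And>x. x \<in> S \<Longrightarrow> norm x \<le> R" using S by (auto simp: bounded_iff)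
  have "bounded (closure (J' ` cball 0 R))"
    using J' by (auto simp: compact_operator_def intro: compact_imp_bounded)
  then obtain K where K: "\<And>x. norm x \<le> R \<Longrightarrow> norm (J' x) \<le> K"
    using closure_subset[of "J' ` cball 0 R"] by (fastforce simp: bounded_iff)
  have "norm (J x) \<le> \<bar>J 0\<bar> + K * R" if "x \<in> S" for x
  proof -
    obtain s where s: "0 < s" "s < 1" "J (0 + x) - J 0 = blinfun_apply (J' (0 + s *\<^sub>R x)) x"
      using C1_mean_value[OF C1] by blast
    have x: "norm x \<le> R" using R that by blast
    have "s * norm x \<le> 1 * norm x" using s by (intro mult_right_mono) auto
    then have K': "norm (J' (s *\<^sub>R x)) \<le> K" using x s by (intro K) simp
    have "\<bar>J x - J 0\<bar> \<le> norm (J' (s *\<^sub>R x)) * norm x"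
      using norm_blinfun[of "J' (s *\<^sub>R x)" x] s(3) by simp
    also have "\<dots> \<le> K * R"
      using K' x order_trans[OF norm_ge_zero K'] by (intro mult_mono) auto
    finally show ?thesis by simp
  qed
  then show ?thesis by (auto simp: bounded_iff)
qed

lemma coercive_bounded_sublevel:
  assumes "coercive f"
  shows "bounded {x. f x \<le> a}"
proof -
  have "\<forall>\<^sub>F x in at_infinity. f x > a"
    using assms unfolding coercive_def by (simp add: filterlim_at_top_dense)
  then obtain b where b: "\<And>x. b \<le> norm x \<Longrightarrow> f x > a" by (auto simp: eventually_at_infinity)
  have "norm x \<le> b" if "f x \<le> a" for x using b[of x] that by linarith
  then show ?thesis by (auto simp: bounded_iff)
qed

text \<open>
  By coercivity, a sequence along which \<open>f\<close> tends to \<open>-\<infinity>\<close> is bounded, so it has a weak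
  limit point, whose value would have to be \<open>-\<infinity>\<close>.
\<close>

lemma seq_weakly_lsc_coercive_bounded_below:
  fixes f :: "'a::banach \<Rightarrow> real"
  assumes uc: "uniformly_convex_space TYPE('a)" and "seq_weakly_lsc f" and "coercive f"
  obtains k where "\<And>x. k \<le> f x"
proof (rule ccontr)
  assume "\<not> thesis"
  then have "\<forall>n. \<exists>x. f x < - real n" using that by (meson not_less)
  then obtain u where u: "\<And>n. f (u n) < - real n" by metis
  have "range u \<subseteq> {x. f x \<le> 0}"
  proof safe
    fix n show "f (u n) \<le> 0" using u[of n] by linarith
  qed
  then have "bounded (range u)" by (rule bounded_subset[OF coercive_bounded_sublevel[OF assms(3)]])
  then obtain s x where s: "strict_mono (s :: nat \<Rightarrow> nat)" "weakly_converges (u \<circ> s) x"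
    using uniformly_convex_weakly_convergent_subseq[OF uc] by blast
  have liminf: "ereal (f x) \<le> liminf (\<lambda>n. ereal (f ((u \<circ> s) n)))"
    using assms(2) s(2) unfolding seq_weakly_lsc_def by blast
  obtain N where N: "real N > - f x + 1" using reals_Archimedean2 by blast
  have "ereal (f x - 1) < liminf (\<lambda>n. ereal (f ((u \<circ> s) n)))"
    using less_le_trans[OF _ liminf, of "ereal (f x - 1)"] by simp
  then have "\<forall>\<^sub>F n in sequentially. ereal (f x - 1) < ereal (f ((u \<circ> s) n))"
    by (rule less_LiminfD)
  then have "\<forall>\<^sub>F n in sequentially. f x - 1 < f (u (s n)) \<and> N \<le> n"
    using eventually_ge_at_top[of N] by eventually_elim simp
  then obtain n where n: "f x - 1 < f (u (s n))" "N \<le> n"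
    using eventually_happens by force
  have "real N \<le> real (s n)" using seq_suble[OF s(1), of n] n(2) by simp
  then show False using u[of "s n"] n(1) N by linarith
qed

text \<open>
  The sublevel sets of \<open>f\<close> in \<open>C\<close> are closed and convex, so each one above the infimum contains a
  closed tail hull of a minimizing sequence, and these hulls have a common point after passing to a
  subsequence.
\<close>

lemma uniformly_convex_attains_min:
  fixes f :: "'a::banach \<Rightarrow> real"
  assumes uc: "uniformly_convex_space TYPE('a)"
    and C: "closed C" "bounded C" "C \<noteq> {}"
    and f: "convex_on C f" "continuous_on C f" "bdd_below (f ` C)"
  obtains x where "x \<in> C" "\<And>y. y \<in> C \<Longrightarrow> f x \<le> f y"
proof -
  define i where "i = Inf (f ` C)"
  have "\<exists>x\<in>C. f x < i + inverse (real (Suc n))" for n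
  proof -
    have "Inf (f ` C) < i + inverse (real (Suc n))" by (simp add: i_def)
    then show ?thesis using C(3) f(3) by (subst (asm) cInf_less_iff) auto
  qed
  then obtain u where u: "\<And>n. u n \<in> C" "\<And>n. f (u n) < i + inverse (real (Suc n))" by metis
  have "bounded (range u)" using u(1) by (intro bounded_subset[OF C(2)]) auto
  then obtain s :: "nat \<Rightarrow> nat" and x where s: "strict_mono s"
    and x: "\<And>(r :: nat \<Rightarrow> nat) m. strict_mono r \<Longrightarrow> x \<in> closure (tail_hull (u \<circ> s \<circ> r) m)"
    using uniformly_convex_tail_hull_subseq[OF uc] by blast
  have sub: "x \<in> {y \<in> C. f y \<le> i + inverse (real (Suc m))}" for m
  proof -
    define L where "L = {y \<in> C. f y \<le> i + inverse (real (Suc m))}"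
    have "convex L"
    proof (rule convexI)
      fix y z a b :: _ assume yz: "y \<in> L" "z \<in> L" and ab: "0 \<le> (a::real)" "0 \<le> b" "a + b = 1"
      then have "a *\<^sub>R y + b *\<^sub>R z \<in> C"
        using convexD[OF convex_on_imp_convex[OF f(1)]] by (simp add: L_def)
      moreover have "f (a *\<^sub>R y + b *\<^sub>R z) \<le> a * f y + b * f z"
        using f(1) yz ab by (simp add: convex_on_def L_def)
      moreover have "a * f y + b * f z \<le> i + inverse (real (Suc m))"
        using yz ab by (intro convex_bound_le) (auto simp: L_def)
      ultimately show "a *\<^sub>R y + b *\<^sub>R z \<in> L" by (simp add: L_def)
    qed
    moreover have "closed L"
      unfolding L_def by (rule continuous_on_closed_Collect_le[OF f(2) continuous_on_const C(1)])
    moreover have "(u \<circ> s \<circ> id) ` {m..} \<subseteq> L"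
    proof safe
      fix n assume "m \<le> n"
      then have "m \<le> s n" using seq_suble[OF s, of n] by simp
      then have "inverse (real (Suc (s n))) \<le> inverse (real (Suc m))"
        by (intro le_imp_inverse_le) auto
      then have "f (u (s n)) \<le> i + inverse (real (Suc m))" using u(2)[of "s n"] by linarith
      then show "(u \<circ> s \<circ> id) n \<in> L" using u(1) by (simp add: L_def)
    qed
    ultimately have "closure (tail_hull (u \<circ> s \<circ> id) m) \<subseteq> L"
      unfolding tail_hull_def by (intro closure_minimal hull_minimal)
    then show ?thesis using x[OF strict_mono_id] unfolding L_def by blast
  qed
  have "(\<lambda>m. i + inverse (real (Suc m))) \<longlonglongrightarrow> i + 0"
    by (intro tendsto_add tendsto_const LIMSEQ_inverse_real_of_nat)
  then have "f x \<le> i + 0"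
    by (rule LIMSEQ_le_const) (use sub in blast)
  moreover have "i \<le> f y" if "y \<in> C" for y
    unfolding i_def using that f(3) by (auto intro: cInf_lower)
  ultimately show thesis using that sub by force
qed

text \<open>
  A segment from \<open>a\<close> to \<open>b\<close> meets the level set \<open>{g = r}\<close>, where \<open>J\<close> exceeds \<open>J a\<close>;
  convexity then forbids \<open>J b < J a\<close>. In this way a minimum of \<open>J\<close> over a sublevel set of
  \<open>\<mu>\<^sub>2\<close> becomes a minimum over the larger sublevel set of \<open>\<mu>\<^sub>1\<close>.
\<close>

lemma convex_minimum_across_wall:
  fixes g :: "'a::real_normed_vector \<Rightarrow> real"
  assumes J: "convex_on D J" "a \<in> D" "b \<in> D" and g: "continuous_on UNIV g" "g a \<le> r" "r \<le> g b"
    and wall: "\<And>x. g x = r \<Longrightarrow> J a < J x"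
  shows "J a \<le> J b"
proof -
  define p where "p t = (1 - t) *\<^sub>R a + t *\<^sub>R b" for t :: real
  have "continuous_on {0..1} (\<lambda>t. g (p t))"
    unfolding p_def by (intro continuous_on_compose2[OF g(1)] continuous_intros) auto
  moreover have "g (p 0) \<le> r" "r \<le> g (p 1)" using g by (auto simp: p_def)
  ultimately obtain t where t: "0 \<le> t" "t \<le> 1" "g (p t) = r"
    using IVT'[of "\<lambda>t. g (p t)" 0 r 1] by auto
  have "J a < J (p t)" by (rule wall[OF t(3)])
  also have "\<dots> \<le> (1 - t) * J a + t * J b"
    using convex_onD[OF J(1) t(1,2) J(2,3)] by (simp add: p_def)
  finally have "0 < t * (J b - J a)" by (simp add: algebra_simps)
  then show ?thesis using t(1) by (simp add: zero_less_mult_iff)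
qed

text \<open>
  If the values of \<open>\<mu> + l * J\<close> stay bounded, so does the sequence, by coercivity. Then the
  \<open>J'\<close>-terms converge along a subsequence, hence so do the \<open>\<mu>'\<close>-terms, and the continuous
  inverse of \<open>\<mu>'\<close> recovers convergence of the points.
\<close>

lemma palais_smale_compact_perturbation:
  fixes \<mu> J :: "'a::real_normed_vector \<Rightarrow> real"
  assumes inv: "admits_continuous_inverse \<mu>'" and J': "compact_operator J'"
    and coer: "coercive (\<lambda>x. \<mu> x + l * J x)"
  shows "palais_smale (\<lambda>x. \<mu> x + l * J x) (\<lambda>x. \<mu>' x + l *\<^sub>R J' x)"
  unfolding palais_smale_def
proof safe
  fix u :: "nat \<Rightarrow> 'a"
  assume bdd: "bounded (range (\<lambda>n. \<mu> (u n) + l * J (u n)))"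
    and lim: "(\<lambda>n. \<mu>' (u n) + l *\<^sub>R J' (u n)) \<longlonglongrightarrow> 0"
  obtain c where c: "\<And>n. \<mu> (u n) + l * J (u n) \<le> c"
    using bounded_imp_bdd_above[OF bdd] by (auto simp: bdd_above_def)
  have "bounded (range u)"
    by (rule bounded_subset[OF coercive_bounded_sublevel[OF coer, of c]]) (use c in auto)
  then have "compact (closure (J' ` range u))"
    using J' by (simp add: compact_operator_def)
  moreover have "\<forall>n. J' (u n) \<in> closure (J' ` range u)"
    using closure_subset by fastforce
  ultimately obtain \<psi> s where s: "strict_mono (s :: nat \<Rightarrow> nat)"
    and \<psi>: "((\<lambda>n. J' (u n)) \<circ> s) \<longlonglongrightarrow> \<psi>"
    using seq_compactE[OF compact_imp_seq_compact] by metis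
  have "(\<lambda>n. \<mu>' (u (s n)) + l *\<^sub>R J' (u (s n))) \<longlonglongrightarrow> 0"
    using LIMSEQ_subseq_LIMSEQ[OF lim s] by (simp add: o_def)
  then have "(\<lambda>n. (\<mu>' (u (s n)) + l *\<^sub>R J' (u (s n))) - l *\<^sub>R J' (u (s n))) \<longlonglongrightarrow> 0 - l *\<^sub>R \<psi>"
    using \<psi> by (intro tendsto_diff tendsto_scaleR tendsto_const) (simp_all add: o_def)
  then have "(\<lambda>n. \<mu>' (u (s n))) \<longlonglongrightarrow> - (l *\<^sub>R \<psi>)" by simp
  moreover have "isCont (inv \<mu>') (- (l *\<^sub>R \<psi>))"
    using inv by (simp add: admits_continuous_inverse_def continuous_on_eq_continuous_at)
  ultimately have "(\<lambda>n. inv \<mu>' (\<mu>' (u (s n)))) \<longlonglongrightarrow> inv \<mu>' (- (l *\<^sub>R \<psi>))"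
    by (rule isCont_tendsto_compose[rotated])
  then have "(\<lambda>n. u (s n)) \<longlonglongrightarrow> inv \<mu>' (- (l *\<^sub>R \<psi>))"
    using inv by (simp add: admits_continuous_inverse_def bij_is_inj)
  then show "\<exists>(s :: nat \<Rightarrow> nat) x. strict_mono s \<and> (\<lambda>n. u (s n)) \<longlonglongrightarrow> x" using s by blast
qed

lemma coercive_perturbation:
  fixes J \<mu>\<^sub>1 \<mu>\<^sub>2 :: "'a::real_normed_vector \<Rightarrow> real"
  assumes coer: "coercive \<mu>\<^sub>2" and ge: "\<forall>\<^sub>F x in at_infinity. \<mu>\<^sub>2 x \<le> \<mu>\<^sub>1 x"
    and J: "0 \<le> Liminf at_infinity (\<lambda>x. ereal (J x / \<mu>\<^sub>2 x))" and l: "0 < l"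
  shows "coercive (\<lambda>x. \<mu>\<^sub>1 x + l * J x)"
  unfolding coercive_def
proof (rule filterlim_at_top_mono)
  show "filterlim (\<lambda>x. (1/2) * \<mu>\<^sub>2 x) at_top at_infinity"
    using coer unfolding coercive_def by (intro filterlim_tendsto_pos_mult_at_top[OF tendsto_const]) auto
  (* The constant is chosen so that l * J costs at most half of \<mu>\<^sub>2. *)
  have "ereal (- 1 / (2 * l)) < Liminf at_infinity (\<lambda>x. ereal (J x / \<mu>\<^sub>2 x))"
    by (rule less_le_trans[OF _ J]) (use l in simp)
  then have "\<forall>\<^sub>F x in at_infinity. ereal (- 1 / (2 * l)) < ereal (J x / \<mu>\<^sub>2 x)"
    by (rule less_LiminfD)
  moreover have "\<forall>\<^sub>F x in at_infinity. 0 < \<mu>\<^sub>2 x"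
    using coer unfolding coercive_def by (simp add: filterlim_at_top_dense)
  ultimately show "\<forall>\<^sub>F x in at_infinity. (1/2) * \<mu>\<^sub>2 x \<le> \<mu>\<^sub>1 x + l * J x"
    using ge
  proof eventually_elim
    case (elim x)
    then have "- 1 / (2 * l) * \<mu>\<^sub>2 x < J x" by (simp add: pos_less_divide_eq)
    then have "l * (- 1 / (2 * l) * \<mu>\<^sub>2 x) < l * J x" using l by (rule mult_strict_left_mono)
    then show ?case using elim(3) l by simp
  qed
qed

lemma C1_add_scaled:
  assumes "C1_with_derivative f f'" "C1_with_derivative g g'"
  shows "C1_with_derivative (\<lambda>x. f x + l * g x) (\<lambda>x. f' x + l *\<^sub>R g' x)"
  unfolding C1_with_derivative_def
proof safe
  fix x
  have "((\<lambda>x. f x + l * g x) has_derivative (\<lambda>h. f' x h + l * g' x h)) (at x)"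
    using assms by (auto simp: C1_with_derivative_def intro!: derivative_intros)
  then show "((\<lambda>x. f x + l * g x) has_derivative blinfun_apply (f' x + l *\<^sub>R g' x)) (at x)"
    by (rule has_derivative_eq_rhs) (auto simp: blinfun.add_left blinfun.scaleR_left)
next
  show "continuous_on UNIV (\<lambda>x. f' x + l *\<^sub>R g' x)"
    using assms by (auto simp: C1_with_derivative_def intro!: continuous_intros)
qed

theorem theorem7:
  fixes J \<mu>\<^sub>1 \<mu>\<^sub>2 :: "'a::banach \<Rightarrow> real"
    and J' \<mu>\<^sub>1' \<mu>\<^sub>2' :: "'a \<Rightarrow> 'a \<Rightarrow>\<^sub>L real"
    and y :: 'a and r :: real
  assumes "uniformly_convex_space TYPE('a)"
    and "strictly_convex_space TYPE('a \<Rightarrow>\<^sub>L real)"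
    and "C1_with_derivative J J'" and "compact_operator J'"
    and "C1_with_derivative \<mu>\<^sub>1 \<mu>\<^sub>1'" and "seq_weakly_lsc \<mu>\<^sub>1" and "coercive \<mu>\<^sub>1"
    and "C1_with_derivative \<mu>\<^sub>2 \<mu>\<^sub>2'" and "\<forall>x. 0 \<le> \<mu>\<^sub>2 x"
    and "convex_on UNIV \<mu>\<^sub>2" and "coercive \<mu>\<^sub>2"
    and "admits_continuous_inverse \<mu>\<^sub>1'"
    and "r > 0"
    and "Liminf at_infinity (\<lambda>x. ereal (J x / \<mu>\<^sub>2 x)) \<ge> 0"
    and "(INF x. ereal (J x)) < (INF x\<in>{x. \<mu>\<^sub>1 x \<le> r}. ereal (J x))"
    and "\<mu>\<^sub>2 y < r" and "ereal (J y) < (INF x\<in>{x. \<mu>\<^sub>2 x = r}. ereal (J x))"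
    and "\<forall>x. \<mu>\<^sub>2 x \<le> r \<longrightarrow> \<mu>\<^sub>1 x \<le> \<mu>\<^sub>2 x"
    and "\<exists>M>0. \<forall>x. norm x \<ge> M \<longrightarrow> \<mu>\<^sub>1 x \<ge> \<mu>\<^sub>2 x"
    and "convex_on (convex hull {x. \<mu>\<^sub>1 x \<le> r}) J"
  shows "\<exists>A :: real set. open A \<and> A \<noteq> {} \<and> A \<subseteq> {0<..} \<and>
           (\<forall>l\<in>A. \<exists>S. card S = 3 \<and> (\<forall>x\<in>S. critical_point (\<lambda>x. \<mu>\<^sub>1 x + l * J x) x))"
proof -
  define B where "B = {x. \<mu>\<^sub>1 x \<le> r}"
  define C where "C = {x. \<mu>\<^sub>2 x \<le> r}"
  have cJ: "continuous_on UNIV J" and c1: "continuous_on UNIV \<mu>\<^sub>1" and c2: "continuous_on UNIV \<mu>\<^sub>2"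
    using C1_continuous(1) assms(3,5,8) by (auto simp: continuous_on_eq_continuous_at)
  have CB: "C \<subseteq> B" using assms(18) by (force simp: B_def C_def)
  have Jwall: "J y < J x" if "\<mu>\<^sub>2 x = r" for x
    using less_INF_D[OF assms(17), of x] that by simp
  obtain k where k: "\<And>x. k \<le> \<mu>\<^sub>1 x"
    using seq_weakly_lsc_coercive_bounded_below[OF assms(1,6,7)] by blast

  have "bounded C" unfolding C_def by (rule coercive_bounded_sublevel[OF assms(11)])
  have "convex C"
    unfolding C_def convex_def
  proof safe
    fix x z and a b :: real assume "\<mu>\<^sub>2 x \<le> r" "\<mu>\<^sub>2 z \<le> r" "0 \<le> a" "0 \<le> b" "a + b = 1"
    moreover from this have "\<mu>\<^sub>2 (a *\<^sub>R x + b *\<^sub>R z) \<le> a * \<mu>\<^sub>2 x + b * \<mu>\<^sub>2 z"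
      using assms(10) by (simp add: convex_on_def)
    ultimately show "\<mu>\<^sub>2 (a *\<^sub>R x + b *\<^sub>R z) \<le> r"
      using convex_bound_le[of "\<mu>\<^sub>2 x" r "\<mu>\<^sub>2 z" a b] by linarith
  qed
  have hull: "C \<subseteq> convex hull B" "B \<subseteq> convex hull B" using CB hull_subset[of B convex] by auto
  have "convex_on C J"
    using assms(20) hull(1) \<open>convex C\<close> unfolding B_def[symmetric] convex_on_def by blast
  then obtain x0 where x0: "x0 \<in> C" "\<And>x. x \<in> C \<Longrightarrow> J x0 \<le> J x"
  proof (rule uniformly_convex_attains_min[OF assms(1), rotated 3])
    show "closed C" unfolding C_def by (intro closed_Collect_le c2 continuous_on_const)
    show "C \<noteq> {}" using less_imp_le[OF assms(16)] by (auto simp: C_def)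
    show "bdd_below (J ` C)"
      by (intro bounded_imp_bdd_below bounded_image_compact_derivative[OF assms(3,4) \<open>bounded C\<close>])
  qed (use \<open>bounded C\<close> continuous_on_subset[OF cJ subset_UNIV] in auto)
  have "J x0 \<le> J y" using x0(2) assms(16) by (simp add: C_def)
  then have x0wall: "J x0 < J x" if "\<mu>\<^sub>2 x = r" for x using Jwall[OF that] by simp
  then have "\<mu>\<^sub>2 x0 < r" using x0(1) by (force simp: C_def)
  then have \<mu>x0: "\<mu>\<^sub>1 x0 < r" using assms(18) by (metis le_less_trans less_imp_le)
  (* Inside C this is the choice of x0; outside, the level set \<mu>\<^sub>2 = r separates x from x0. *)
  have Bmin: "J x0 \<le> J x" if "x \<in> B" for x
  proof (cases "x \<in> C")
    case False
    show ?thesis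
    proof (rule convex_minimum_across_wall[OF assms(20) _ _ c2, where r = r])
      show "x0 \<in> convex hull {x. \<mu>\<^sub>1 x \<le> r}" "x \<in> convex hull {x. \<mu>\<^sub>1 x \<le> r}"
        using hull x0(1) that by (auto simp: B_def)
    qed (use x0(1) False x0wall in \<open>auto simp: C_def\<close>)
  qed (rule x0(2))
  obtain z where z: "J z < J x0"
  proof -
    obtain z where "ereal (J z) < (INF x\<in>{x. \<mu>\<^sub>1 x \<le> r}. ereal (J x))"
      using assms(15) unfolding INF_less_iff by blast
    from less_INF_D[OF this, of x0] \<mu>x0 that show thesis by simp
  qed
  then have zB: "\<mu>\<^sub>1 z > r" using Bmin[of z] by (force simp: B_def)

  (* Beyond \<Lambda> the gain l * (J x0 - J z) outweighs the cost of leaving B, which is at most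
     \<mu>\<^sub>1 z - k. *)
  define \<Lambda> where "\<Lambda> = max 0 ((\<mu>\<^sub>1 z - k) / (J x0 - J z))"
  have "\<exists>S. card S = 3 \<and> (\<forall>x\<in>S. critical_point (\<lambda>x. \<mu>\<^sub>1 x + l * J x) x)" if "l \<in> {\<Lambda><..}" for l
  proof -
    have l: "l > 0" "(\<mu>\<^sub>1 z - k) / (J x0 - J z) < l" using that by (auto simp: \<Lambda>_def)
    define E where "E x = \<mu>\<^sub>1 x + l * J x" for x
    define E' where "E' x = \<mu>\<^sub>1' x + l *\<^sub>R J' x" for x
    define \<rho> where "\<rho> = r + l * J x0"
    have C1: "C1_with_derivative E E'"
      unfolding E_def E'_def by (rule C1_add_scaled[OF assms(5,3)])
    have "\<forall>\<^sub>F x in at_infinity. \<mu>\<^sub>2 x \<le> \<mu>\<^sub>1 x"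
      using assms(19) unfolding eventually_at_infinity by blast
    then have coer: "coercive E"
      unfolding E_def by (rule coercive_perturbation[OF assms(11) _ assms(14) l(1)])
    have ps: "palais_smale E E'"
      unfolding E_def E'_def
      by (rule palais_smale_compact_perturbation[OF assms(12,4) coer[unfolded E_def]])
    have E_ge: "\<rho> \<le> E x" if "\<mu>\<^sub>1 x = r" for x
      using Bmin[of x] that l(1) by (simp add: B_def E_def \<rho>_def)
    have E_x0: "E x0 < \<rho>" using \<mu>x0 by (simp add: E_def \<rho>_def)
    have E_z: "E z < E x" if "x \<in> B" for x
    proof -
      have "\<mu>\<^sub>1 z - k < l * (J x0 - J z)" using l(2) z by (simp add: pos_divide_less_eq)
      then have "E z < k + l * J x0" by (simp add: E_def algebra_simps)
      also have "\<dots> \<le> E x" unfolding E_def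
        using k Bmin[OF that] l(1) by (intro add_mono mult_left_mono) auto
      finally show ?thesis .
    qed
    have x0B: "x0 \<in> B" using \<mu>x0 by (simp add: B_def)
    obtain e where e: "\<And>x. e \<le> E x"
    proof -
      have "bounded (J ` {x. E x \<le> 0})"
        by (intro bounded_image_compact_derivative[OF assms(3,4)] coercive_bounded_sublevel coer)
      then obtain j where "\<forall>c\<in>J ` {x. E x \<le> 0}. j \<le> c"
        using bounded_imp_bdd_below unfolding bdd_below_def by blast
      then have j: "\<And>x. E x \<le> 0 \<Longrightarrow> j \<le> J x" by auto
      have "min 0 (k + l * j) \<le> E x" for x
      proof (cases "E x \<le> 0")
        case True
        then have "l * j \<le> l * J x" using j l(1) by simp
        then have "k + l * j \<le> E x" unfolding E_def by (intro add_mono k)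
        then show ?thesis by simp
      qed simp
      then show thesis using that by blast
    qed

    obtain x1 where x1: "E' x1 = 0" "x1 \<in> B" "\<And>x. x \<in> B \<Longrightarrow> E x1 \<le> E x"
    proof (rule minimum_critical[OF C1 ps _ x0B])
      show "closed B" unfolding B_def by (intro closed_Collect_le c1 continuous_on_const)
      show "x \<in> interior B" if "x \<in> B" "E x \<le> E x0" for x
      proof (rule interiorI)
        show "open {x. \<mu>\<^sub>1 x < r}" by (intro open_Collect_less c1 continuous_on_const)
        show "x \<in> {x. \<mu>\<^sub>1 x < r}" using E_ge[of x] E_x0 that by (force simp: B_def)
      qed (auto simp: B_def)
    qed (use e in auto)
    obtain x3 where x3: "E' x3 = 0" "\<And>x. E x3 \<le> E x"
      using minimum_critical[OF C1 ps closed_UNIV UNIV_I e, of x0] by auto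
    obtain x2 where x2: "E' x2 = 0" "\<rho> \<le> E x2"
    proof (rule mountain_pass[OF C1 ps E_x0])
      show "E z < \<rho>" using E_z[OF x0B] E_x0 by simp
      fix p :: "real \<Rightarrow> 'a" assume p: "continuous_on {0..1} p" "p 0 = x0" "p 1 = z"
      have "continuous_on {0..1} (\<lambda>t. \<mu>\<^sub>1 (p t))" by (rule continuous_on_compose2[OF c1 p(1)]) auto
      then obtain t where "0 \<le> t" "t \<le> 1" "\<mu>\<^sub>1 (p t) = r"
        using IVT'[of "\<lambda>t. \<mu>\<^sub>1 (p t)" 0 r 1] p \<mu>x0 zB by auto
      then show "\<exists>t\<in>{0..1}. \<rho> \<le> E (p t)" using E_ge by (intro bexI[of _ t]) auto
    qed
    have "E x3 < E x1" using E_z[OF x1(2)] x3(2)[of z] by simp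
    moreover have "E x1 < E x2" using x1(3)[OF x0B] E_x0 x2(2) by simp
    ultimately have "card {x1, x2, x3} = 3" by (auto simp: card_insert_if)
    moreover have "critical_point E x" if "E' x = 0" for x
    proof -
      have "(E has_derivative blinfun_apply (E' x)) (at x)"
        using C1 by (simp add: C1_with_derivative_def)
      then show ?thesis using that by (simp add: critical_point_def zero_blinfun.rep_eq)
    qed
    ultimately show ?thesis using x1(1) x2(1) x3(1) unfolding E_def
      by (intro exI[of _ "{x1, x2, x3}"]) auto
  qed
  then show ?thesis
    by (intro exI[of _ "{\<Lambda><..}"]) (auto simp: \<Lambda>_def intro: gt_ex)
qed

end
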